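(* Let $G$ be a connected graph of order $n$. (i) Let $t$ be a positive integer and $n\ge 4t^2+10t$. If $\lambda_1(D(G))\le \lambda_1\big(D(K_{2t-1}\vee(K_{n-2t}+K_1))\big)$, then $G$ is $t$-tough unless $G\cong K_{2t-1}\vee(K_{n-2t}+K_1)$. (ii) Let $t>0$ be such that $1/t$ is a positive integer, and let $n\ge 2t+\frac{9}{2t}+\frac92$. If $\lambda_1(D(G))\le \lambda_1\big(D(K_1\vee(K_{n-1-\frac1t}+\tfrac1t K_1))\big)$, then $G$ is $t$-tough unless $G\cong K_1\vee(K_{n-1-\frac1t}+\tfrac1t K_1)$.
   Context: All graphs are finite, simple and undirected. For a connected graph $G$, $D(G)$ is its distance matrix (entry $(i,j)$ = distance between $v_i$ and $v_j$), and $\lambda_1(D(G))$ its largest eigenvalue. $c(H)$ is the number of components of $H$. For $G\not\cong K_n$, the toughness is $\tau(G)=\min\{|S|/c(G-S): S\text{ a vertex cut of }G\}$, and $G$ is $t$-tough if $\tau(G)\ge t$. $K_m$ is the complete graph, $+$ denotes disjoint union, $sH$ is $s$ disjoint copies of $H$, and $G_1\vee G_2$ is the join (disjoint union plus all edges between the two parts). *)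

theory Defs
  imports Complex_Main
begin

record 'a sgraph =
  gverts :: "'a set"
  gadj :: "'a \<Rightarrow> 'a \<Rightarrow> bool"

definition simple_graph :: "'a sgraph \<Rightarrow> bool" where
  "simple_graph G \<longleftrightarrow> finite (gverts G) \<and>
     (\<forall>u v. gadj G u v \<longrightarrow> u \<in> gverts G \<and> v \<in> gverts G \<and> u \<noteq> v \<and> gadj G v u)"

text \<open>Walks as nonempty vertex lists; length of the walk is length - 1.\<close>

definition walk :: "'a sgraph \<Rightarrow> 'a list \<Rightarrow> bool" where
  "walk G xs \<longleftrightarrow> xs \<noteq> [] \<and> set xs \<subseteq> gverts G \<and>
     (\<forall>i. Suc i < length xs \<longrightarrow> gadj G (xs ! i) (xs ! Suc i))"

definition reachable :: "'a sgraph \<Rightarrow> 'a \<Rightarrow> 'a \<Rightarrow> bool" where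
  "reachable G u v \<longleftrightarrow> (\<exists>xs. walk G xs \<and> hd xs = u \<and> last xs = v)"

definition connected_graph :: "'a sgraph \<Rightarrow> bool" where
  "connected_graph G \<longleftrightarrow> gverts G \<noteq> {} \<and>
     (\<forall>u\<in>gverts G. \<forall>v\<in>gverts G. reachable G u v)"

definition gdist :: "'a sgraph \<Rightarrow> 'a \<Rightarrow> 'a \<Rightarrow> nat" where
  "gdist G u v = (LEAST k. \<exists>xs. walk G xs \<and> hd xs = u \<and> last xs = v \<and> length xs = Suc k)"

text \<open>Eigenvalues of the distance matrix D(G) (rows/columns indexed by the vertices).
  D(G) is real symmetric, so all its eigenvalues are real with real eigenvectors.\<close>

definition dist_eigenvalues :: "'a sgraph \<Rightarrow> real set" where
  "dist_eigenvalues G = {mu. \<exists>x :: 'a \<Rightarrow> real.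
      (\<exists>v\<in>gverts G. x v \<noteq> 0) \<and>
      (\<forall>u\<in>gverts G. (\<Sum>v\<in>gverts G. real (gdist G u v) * x v) = mu * x u)}"

definition dist_lambda1 :: "'a sgraph \<Rightarrow> real" where
  "dist_lambda1 G = Max (dist_eigenvalues G)"

definition delete_verts :: "'a sgraph \<Rightarrow> 'a set \<Rightarrow> 'a sgraph" where
  "delete_verts G S = \<lparr> gverts = gverts G - S,
      gadj = (\<lambda>u v. gadj G u v \<and> u \<notin> S \<and> v \<notin> S) \<rparr>"

definition num_components :: "'a sgraph \<Rightarrow> nat" where
  "num_components H = card {{v \<in> gverts H. reachable H u v} | u. u \<in> gverts H}"

definition vertex_cut :: "'a sgraph \<Rightarrow> 'a set \<Rightarrow> bool" where
  "vertex_cut G S \<longleftrightarrow> S \<subseteq> gverts G \<and> num_components (delete_verts G S) \<ge> 2"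

definition is_complete :: "'a sgraph \<Rightarrow> bool" where
  "is_complete G \<longleftrightarrow> (\<forall>u\<in>gverts G. \<forall>v\<in>gverts G. u \<noteq> v \<longrightarrow> gadj G u v)"

definition toughness :: "'a sgraph \<Rightarrow> real" where
  "toughness G = Min {real (card S) / real (num_components (delete_verts G S)) | S. vertex_cut G S}"

text \<open>t-tough: tau(G) >= t; complete graphs have tau = infinity by convention.\<close>

definition tough :: "'a sgraph \<Rightarrow> real \<Rightarrow> bool" where
  "tough G t \<longleftrightarrow> is_complete G \<or> toughness G \<ge> t"

definition graph_iso :: "'a sgraph \<Rightarrow> 'b sgraph \<Rightarrow> bool" where
  "graph_iso G H \<longleftrightarrow> (\<exists>f. bij_betw f (gverts G) (gverts H) \<and>
     (\<forall>u\<in>gverts G. \<forall>v\<in>gverts G. gadj G u v \<longleftrightarrow> gadj H (f u) (f v)))"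

definition complete_graph :: "nat \<Rightarrow> nat sgraph" where
  "complete_graph m = \<lparr> gverts = {0..<m}, gadj = (\<lambda>u v. u < m \<and> v < m \<and> u \<noteq> v) \<rparr>"

fun union_adj :: "('a \<Rightarrow> 'a \<Rightarrow> bool) \<Rightarrow> ('b \<Rightarrow> 'b \<Rightarrow> bool) \<Rightarrow> 'a + 'b \<Rightarrow> 'a + 'b \<Rightarrow> bool" where
  "union_adj A B (Inl a) (Inl a') = A a a'"
| "union_adj A B (Inr b) (Inr b') = B b b'"
| "union_adj A B _ _ = False"

definition disj_union :: "'a sgraph \<Rightarrow> 'b sgraph \<Rightarrow> ('a + 'b) sgraph" where
  "disj_union G H = \<lparr> gverts = Inl ` gverts G \<union> Inr ` gverts H,
      gadj = union_adj (gadj G) (gadj H) \<rparr>"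

definition graph_join :: "'a sgraph \<Rightarrow> 'b sgraph \<Rightarrow> ('a + 'b) sgraph" where
  "graph_join G H = \<lparr> gverts = Inl ` gverts G \<union> Inr ` gverts H,
      gadj = (\<lambda>x y. union_adj (gadj G) (gadj H) x y \<or>
         (\<exists>a\<in>gverts G. \<exists>b\<in>gverts H. (x = Inl a \<and> y = Inr b) \<or> (x = Inr b \<and> y = Inl a))) \<rparr>"

definition copies :: "nat \<Rightarrow> 'a sgraph \<Rightarrow> (nat \<times> 'a) sgraph" where
  "copies s H = \<lparr> gverts = {0..<s} \<times> gverts H,
      gadj = (\<lambda>(i, a) (j, b). i = j \<and> i < s \<and> gadj H a b) \<rparr>"

end

theory Submission
  imports Defs "HOL-Analysis.Function_Topology" "HOL-Library.Disjoint_Sets"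
begin

text \<open>Let \<open>S\<close> be a cut of size \<open>s\<close> whose removal leaves blocks of sizes \<open>n\<^sub>i\<close>. The distance matrix
  dominates the one of the join of a clique on \<open>S\<close> with a disjoint union of cliques on the blocks,
  whose largest eigenvalue \<open>L - 1\<close> is the root of the secular equation
  \<open>\<Sum>\<^sub>i n\<^sub>i / (L + n\<^sub>i) = (L - s) / (2 L - s)\<close>. The summands are concave in \<open>n\<^sub>i\<close>, so the sum is smallest
  when all blocks but one are single vertices. Taking \<open>L\<close> from the extremal graph, the left-hand side
  for a cut violating toughness is at least the right-hand side, with equality for the extremal graph
  only. For integral \<open>t\<close> and at least three blocks the cruder all-ones test vector suffices.\<close>

section \<open>Spectra of real symmetric matrices\<close>

text \<open>Two spectral radii are never compared as functions of block sizes. The number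
  \<open>L\<close> is fixed by the extremal graph, and every other cut is tested with its own trial
  vector at this same \<open>L\<close>; only the sign of the defect in the secular equation matters.
  The extremal graph needs just an upper bound on \<open>dist_lambda1\<close>, supplied by a
  positive supervector; \<open>G\<close> needs just a Rayleigh quotient. Hence neither the
  Perron-Frobenius theorem nor monotonicity of the root is invoked. A nonnegative defect gives
  \<open>dist_lambda1 G\<close> at least \<open>L - 1\<close>, the hypothesis gives the converse,
  and positivity of the trial vector then forces every single distance, which yields the
  isomorphism. For integral t the obstacle is that the cut may have up to about t times as many
  vertices as there are blocks, so S can take up a large part of the graph. With three or more
  blocks the lower bound on n pays for a plain count: the extremal eigenvalue stays below n + 2,
  whereas the average row sum of the distance matrix reaches n + 2.\<close>

definition eigenpair :: "'a set \<Rightarrow> ('a \<Rightarrow> 'a \<Rightarrow> real) \<Rightarrow> real \<Rightarrow> ('a \<Rightarrow> real) \<Rightarrow> bool" where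
  "eigenpair V A \<mu> x \<longleftrightarrow> (\<exists>v\<in>V. x v \<noteq> 0) \<and> (\<forall>u\<in>V. (\<Sum>v\<in>V. A u v * x v) = \<mu> * x u)"

definition quad_form :: "'a set \<Rightarrow> ('a \<Rightarrow> 'a \<Rightarrow> real) \<Rightarrow> ('a \<Rightarrow> real) \<Rightarrow> real" where
  "quad_form V A x = (\<Sum>u\<in>V. x u * (\<Sum>v\<in>V. A u v * x v))"

lemma quad_form_scale: "quad_form V A (\<lambda>v. c * x v) = c\<^sup>2 * quad_form V A x"
  by (simp add: quad_form_def sum_distrib_left power2_eq_square mult_ac)

lemma quad_form_cong: "(\<And>v. v \<in> V \<Longrightarrow> x v = y v) \<Longrightarrow> quad_form V A x = quad_form V A y"
  unfolding quad_form_def by (intro sum.cong refl arg_cong2[of _ _ _ _ "(*)"]) auto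

lemma quad_form_attains_max_on_sphere:
  fixes V :: "'a set"
  assumes "finite V" "V \<noteq> {}"
  obtains x where "(\<Sum>v\<in>V. (x v)\<^sup>2) = 1"
    "\<And>y. quad_form V A y \<le> quad_form V A x * (\<Sum>v\<in>V. (y v)\<^sup>2)"
proof -
  \<comment> \<open>The unit sphere over \<open>V\<close> is not compact among functions on the
    whole type, because coordinates outside \<open>V\<close> are free. Pinning them to 0 gives a
    product of compact sets.\<close>
  define K where "K = (\<Pi>\<^sub>E v\<in>UNIV. if v \<in> V then {-1..1::real} else {0})"
  define T where "T = {x :: 'a \<Rightarrow> real. (\<Sum>v\<in>V. (x v)\<^sup>2) = 1}"
  have "compact K"
  proof -
    have "compactin (product_topology (\<lambda>_::'a. euclideanreal) UNIV) K"
      unfolding K_def compactin_PiE by auto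
    then show ?thesis
      by (simp add: euclidean_product_topology)
  qed
  moreover have "closed T"
    unfolding T_def by (intro closed_Collect_eq continuous_intros continuous_on_product_coordinates)
  ultimately have comp: "compact (K \<inter> T)"
    by (rule compact_Int_closed)
  obtain v0 where v0: "v0 \<in> V" using assms by auto
  have "(\<lambda>v. if v = v0 then 1 else 0) \<in> K \<inter> T"
    using v0 assms by (simp add: K_def T_def PiE_iff if_distrib [of "\<lambda>x. x\<^sup>2"] cong: if_cong)
  then have ne: "K \<inter> T \<noteq> {}" by blast
  have "continuous_on (K \<inter> T) (quad_form V A)"
    unfolding quad_form_def
    by (intro continuous_intros continuous_on_product_coordinates[THEN continuous_on_subset]) auto
  from continuous_attains_sup[OF comp ne this] obtain x where
    x: "x \<in> K \<inter> T" "\<And>y. y \<in> K \<inter> T \<Longrightarrow> quad_form V A y \<le> quad_form V A x" by blast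
  have "quad_form V A y \<le> quad_form V A x * (\<Sum>v\<in>V. (y v)\<^sup>2)" for y
  proof (cases "\<forall>v\<in>V. y v = 0")
    case True
    then show ?thesis by (simp add: quad_form_def)
  next
    case False
    define N where "N = (\<Sum>v\<in>V. (y v)\<^sup>2)"
    have N: "N > 0"
      using False assms unfolding N_def by (auto simp: sum_nonneg_eq_0_iff sum_nonneg less_le)
    define z where "z = (\<lambda>v. if v \<in> V then (1 / sqrt N) * y v else 0)"
    have sq: "(z v)\<^sup>2 = (y v)\<^sup>2 / N" if "v \<in> V" for v
      using that N by (simp add: z_def power_mult_distrib power_divide)
    have z1: "(\<Sum>v\<in>V. (z v)\<^sup>2) = 1"
      using N by (simp add: sq sum_divide_distrib[symmetric] N_def[symmetric] cong: sum.cong)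
    have "(z v)\<^sup>2 \<le> 1" if "v \<in> V" for v
      using member_le_sum[of v V "\<lambda>v. (z v)\<^sup>2"] that assms z1 by simp
    then have "\<bar>z v\<bar> \<le> 1" if "v \<in> V" for v
      using that by (simp add: abs_square_le_1)
    then have "z \<in> K \<inter> T"
      using z1 by (simp add: K_def T_def PiE_iff abs_le_iff minus_le_iff) (simp add: z_def)
    then have "quad_form V A z \<le> quad_form V A x" by (rule x)
    moreover have "quad_form V A z = (1 / sqrt N)\<^sup>2 * quad_form V A y"
      unfolding quad_form_scale[symmetric] by (rule quad_form_cong) (simp add: z_def)
    ultimately show ?thesis
      using N by (simp add: power_divide N_def[symmetric] field_simps)
  qed
  with x(1) show ?thesis
    by (intro that[of x]) (auto simp: T_def)
qed

lemma linear_term_eq_0: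
  fixes a b :: real
  assumes "\<And>e. 2 * e * a + e\<^sup>2 * b \<le> 0"
  shows "a = 0"
proof (rule ccontr)
  assume "a \<noteq> 0"
  \<comment> \<open>With this size \<open>\<bar>e * b\<bar>\<close> is at most
    \<open>\<bar>a\<bar>\<close>, so \<open>2 * a + e * b\<close> keeps the sign of
    \<open>a\<close>, which is also the sign of \<open>e\<close>; their product is positive.\<close>
  define e where "e = a / (\<bar>b\<bar> + 1)"
  have "\<bar>e * b\<bar> \<le> \<bar>a\<bar>"
    by (simp add: e_def abs_mult field_simps mult_left_mono)
  moreover have "2 * e * a + e\<^sup>2 * b = e * (2 * a + e * b)"
    by (simp add: algebra_simps power2_eq_square)
  moreover have "e * (2 * a + e * b) > 0"
  proof (cases "a > 0")
    case True
    then have "e > 0" by (simp add: e_def add_nonneg_pos)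
    moreover have "2 * a + e * b > 0" using True \<open>\<bar>e * b\<bar> \<le> \<bar>a\<bar>\<close> by linarith
    ultimately show ?thesis by simp
  next
    case False
    then have "e < 0" using \<open>a \<noteq> 0\<close> by (simp add: e_def divide_neg_pos add_nonneg_pos)
    moreover have "2 * a + e * b < 0" using False \<open>a \<noteq> 0\<close> \<open>\<bar>e * b\<bar> \<le> \<bar>a\<bar>\<close> by linarith
    ultimately show ?thesis by (simp add: mult_neg_neg)
  qed
  ultimately show False using assms[of e] by simp
qed

text \<open>A maximiser on the unit sphere is perturbed in one coordinate \<open>u\<close>. As the
  bound by \<open>\<mu>\<close> times the squared norm holds for all vectors, no Lagrange multiplier
  is needed: the vanishing first variation is row \<open>u\<close> of the eigenvalue
  equation.\<close>

lemma symmetric_max_eigenpair: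
  fixes V :: "'a set"
  assumes fin: "finite V" and "V \<noteq> {}"
    and sym: "\<And>u v. u \<in> V \<Longrightarrow> v \<in> V \<Longrightarrow> A u v = A v u"
  obtains \<mu> x where "eigenpair V A \<mu> x" "\<And>y. quad_form V A y \<le> \<mu> * (\<Sum>v\<in>V. (y v)\<^sup>2)"
proof -
  obtain x where x: "(\<Sum>v\<in>V. (x v)\<^sup>2) = 1"
    "\<And>y. quad_form V A y \<le> quad_form V A x * (\<Sum>v\<in>V. (y v)\<^sup>2)"
    by (rule quad_form_attains_max_on_sphere[OF assms(1,2), of A]) blast
  define \<mu> where "\<mu> = quad_form V A x"
  have "(\<Sum>v\<in>V. A u v * x v) = \<mu> * x u" if u: "u \<in> V" for u
  proof -
    define r where "r = (\<Sum>v\<in>V. A u v * x v)"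
    have "2 * e * (r - \<mu> * x u) + e\<^sup>2 * (A u u - \<mu>) \<le> 0" for e
    proof -
      define d where "d = (\<lambda>v. if v = u then e else (0::real))"
      have dsum: "(\<Sum>v\<in>V. f v * d v) = f u * e" "(\<Sum>v\<in>V. d v * f v) = e * f u" for f
        using fin u by (simp_all add: d_def if_distrib[of "\<lambda>a. _ * a"] if_distrib[of "\<lambda>a. a * _"] cong: if_cong)
      have "(\<Sum>v\<in>V. (x v + d v)\<^sup>2) = (\<Sum>v\<in>V. (x v)\<^sup>2) + 2 * (\<Sum>v\<in>V. x v * d v) + (\<Sum>v\<in>V. d v * d v)"
        by (simp add: power2_sum sum.distrib sum_distrib_left algebra_simps power2_eq_square)
      also have "\<dots> = 1 + 2 * e * x u + e\<^sup>2"
        unfolding dsum x(1) by (simp add: d_def power2_eq_square)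
      finally have n: "(\<Sum>v\<in>V. (x v + d v)\<^sup>2) = 1 + 2 * e * x u + e\<^sup>2" .
      have "quad_form V A (\<lambda>v. x v + d v) =
          (\<Sum>w\<in>V. (x w + d w) * ((\<Sum>v\<in>V. A w v * x v) + A w u * e))"
        unfolding quad_form_def by (simp add: distrib_left sum.distrib dsum)
      also have "\<dots> = \<mu> + (\<Sum>w\<in>V. d w * (\<Sum>v\<in>V. A w v * x v))
          + e * (\<Sum>w\<in>V. A w u * x w) + e * (\<Sum>w\<in>V. d w * A w u)"
        unfolding \<mu>_def quad_form_def by (simp add: algebra_simps sum.distrib sum_distrib_left)
      also have "(\<Sum>w\<in>V. A w u * x w) = r"
        unfolding r_def using sym u by (intro sum.cong) auto
      also have "(\<Sum>w\<in>V. d w * (\<Sum>v\<in>V. A w v * x v)) = e * r"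
        unfolding dsum r_def ..
      finally have "quad_form V A (\<lambda>v. x v + d v) = \<mu> + 2 * e * r + e\<^sup>2 * A u u"
        unfolding dsum by (simp add: power2_eq_square)
      with x(2)[of "\<lambda>v. x v + d v"] n show ?thesis
        by (simp add: \<mu>_def[symmetric] algebra_simps)
    qed
    then have "r - \<mu> * x u = 0" by (rule linear_term_eq_0)
    then show ?thesis by (simp add: r_def)
  qed
  moreover have "\<exists>v\<in>V. x v \<noteq> 0"
    using x(1) by (auto intro: ccontr)
  ultimately show ?thesis
    using x(2) by (intro that[of \<mu> x]) (auto simp: eigenpair_def \<mu>_def)
qed

lemma eigenpairs_orthogonal:
  fixes V :: "'a set"
  assumes sym: "\<And>u v. u \<in> V \<Longrightarrow> v \<in> V \<Longrightarrow> A u v = A v u"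
    and "eigenpair V A \<mu> x" "eigenpair V A \<nu> y" "\<mu> \<noteq> \<nu>"
  shows "(\<Sum>v\<in>V. x v * y v) = 0"
proof -
  have "\<mu> * (\<Sum>v\<in>V. x v * y v) = (\<Sum>u\<in>V. (\<Sum>v\<in>V. A u v * x v) * y u)"
    using assms(2) by (simp add: eigenpair_def sum_distrib_left mult.assoc)
  also have "\<dots> = (\<Sum>u\<in>V. \<Sum>v\<in>V. A u v * x v * y u)"
    by (simp add: sum_distrib_right)
  also have "\<dots> = (\<Sum>v\<in>V. \<Sum>u\<in>V. A v u * x v * y u)"
    using sym by (subst sum.swap) (intro sum.cong refl, auto)
  also have "\<dots> = (\<Sum>v\<in>V. x v * (\<Sum>u\<in>V. A v u * y u))"
    by (simp add: sum_distrib_left mult_ac)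
  also have "\<dots> = \<nu> * (\<Sum>v\<in>V. x v * y v)"
    using assms(3) by (simp add: eigenpair_def sum_distrib_left mult_ac)
  finally show ?thesis using \<open>\<mu> \<noteq> \<nu>\<close> by simp
qed

text \<open>Bessel's inequality for each coordinate unit vector, summed over all coordinates:
  exchanging the sums turns the left-hand side into the sum of the squared norms of the
  family.\<close>

lemma orthonormal_family_bound:
  fixes V :: "'a set" and y :: "'i \<Rightarrow> 'a \<Rightarrow> real"
  assumes "finite V" "finite F"
    and orth: "\<And>i j. i \<in> F \<Longrightarrow> j \<in> F \<Longrightarrow> (\<Sum>v\<in>V. y i v * y j v) = (if i = j then 1 else 0)"
  shows "card F \<le> card V"
proof -
  have "(\<Sum>i\<in>F. (y i w)\<^sup>2) \<le> 1" if w: "w \<in> V" for w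
  proof -
    define p where "p = (\<lambda>v. \<Sum>i\<in>F. y i w * y i v)"
    define q where "q = (\<Sum>i\<in>F. (y i w)\<^sup>2)"
    have pp: "(\<Sum>v\<in>V. (p v)\<^sup>2) = q"
    proof -
      have "(\<Sum>v\<in>V. (p v)\<^sup>2) = (\<Sum>v\<in>V. \<Sum>i\<in>F. \<Sum>j\<in>F. y i w * y j w * (y i v * y j v))"
        by (simp add: p_def power2_eq_square sum_product mult_ac)
      also have "\<dots> = (\<Sum>i\<in>F. \<Sum>v\<in>V. \<Sum>j\<in>F. y i w * y j w * (y i v * y j v))"
        by (rule sum.swap)
      also have "\<dots> = (\<Sum>i\<in>F. \<Sum>j\<in>F. \<Sum>v\<in>V. y i w * y j w * (y i v * y j v))"
        by (intro sum.cong refl sum.swap)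
      also have "\<dots> = (\<Sum>i\<in>F. \<Sum>j\<in>F. y i w * y j w * (if i = j then 1 else 0))"
        by (intro sum.cong refl) (simp add: sum_distrib_left[symmetric] orth)
      also have "\<dots> = q"
        using assms(2) by (simp add: q_def power2_eq_square if_distrib[of "\<lambda>a. _ * a"] cong: if_cong)
      finally show ?thesis .
    qed
    \<comment> \<open>This is the squared norm of the unit vector at \<open>w\<close> minus its
      projection \<open>p\<close> to the span of the family; it evaluates to
      \<open>1 - q\<close>.\<close>
    have "0 \<le> (\<Sum>v\<in>V. ((if v = w then 1 else 0) - p v)\<^sup>2)"
      by (intro sum_nonneg) simp
    also have "\<dots> = (\<Sum>v\<in>V. (if v = w then 1 - 2 * p v else 0) + (p v)\<^sup>2)"
      by (intro sum.cong refl) (auto simp: power2_diff)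
    also have "\<dots> = 1 - 2 * p w + q"
      using assms(1) w by (simp add: sum.distrib pp)
    also have "p w = q" by (simp add: p_def q_def power2_eq_square)
    finally show ?thesis by (simp add: q_def)
  qed
  then have "(\<Sum>w\<in>V. \<Sum>i\<in>F. (y i w)\<^sup>2) \<le> (\<Sum>w\<in>V. 1)"
    by (rule sum_mono)
  also have "(\<Sum>w\<in>V. \<Sum>i\<in>F. (y i w)\<^sup>2) = (\<Sum>i\<in>F. \<Sum>w\<in>V. y i w * y i w)"
    by (subst sum.swap) (simp add: power2_eq_square)
  also have "\<dots> = card F"
    by (simp add: orth)
  finally show ?thesis by simp
qed

text \<open>\<open>dist_lambda1\<close> is a \<open>Max\<close>, which carries information only on a
  finite set. Normalised eigenvectors of distinct eigenvalues are orthonormal, so their number is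
  bounded by the dimension.\<close>

lemma finite_symmetric_eigenvalues:
  fixes V :: "'a set"
  assumes fin: "finite V"
    and sym: "\<And>u v. u \<in> V \<Longrightarrow> v \<in> V \<Longrightarrow> A u v = A v u"
  shows "finite {\<mu>. \<exists>x. eigenpair V A \<mu> x}"
proof (rule finite_if_finite_subsets_card_bdd[THEN conjunct1])
  fix F assume F: "F \<subseteq> {\<mu>. \<exists>x. eigenpair V A \<mu> x}" "finite F"
  then have "\<forall>\<mu>\<in>F. \<exists>x. eigenpair V A \<mu> x" by blast
  then obtain x where x: "\<And>\<mu>. \<mu> \<in> F \<Longrightarrow> eigenpair V A \<mu> (x \<mu>)" by metis
  define N where "N = (\<lambda>\<mu>. sqrt (\<Sum>v\<in>V. (x \<mu> v)\<^sup>2))"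
  define y where "y = (\<lambda>\<mu> v. x \<mu> v / N \<mu>)"
  have N: "(\<Sum>v\<in>V. (x \<mu> v)\<^sup>2) > 0" if "\<mu> \<in> F" for \<mu>
    using x[OF that] fin by (auto simp: eigenpair_def sum_nonneg_eq_0_iff sum_nonneg less_le)
  have "(\<Sum>v\<in>V. y \<mu> v * y \<nu> v) = (if \<mu> = \<nu> then 1 else 0)" if "\<mu> \<in> F" "\<nu> \<in> F" for \<mu> \<nu>
  proof -
    have "(\<Sum>v\<in>V. y \<mu> v * y \<nu> v) = (\<Sum>v\<in>V. x \<mu> v * x \<nu> v) / (N \<mu> * N \<nu>)"
      by (simp add: y_def sum_divide_distrib)
    then show ?thesis
      using eigenpairs_orthogonal[OF sym x x, of \<mu> \<nu>] that N[of \<mu>]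
      by (auto simp: N_def power2_eq_square[symmetric])
  qed
  then show "card F \<le> card V"
    by (rule orthonormal_family_bound[OF fin F(2)])
qed

text \<open>Compare an eigenvector \<open>y\<close> with \<open>x\<close> at the index where \<open>\<bar>y\<bar> / x\<close> is largest.\<close>
lemma eigenvalue_le_of_supervector:
  fixes V :: "'a set"
  assumes fin: "finite V"
    and nonneg: "\<And>u v. u \<in> V \<Longrightarrow> v \<in> V \<Longrightarrow> A u v \<ge> 0"
    and x: "\<And>v. v \<in> V \<Longrightarrow> x v > 0" "\<And>u. u \<in> V \<Longrightarrow> (\<Sum>v\<in>V. A u v * x v) \<le> c * x u"
    and "eigenpair V A \<mu> y"
  shows "\<mu> \<le> c"
proof -
  from assms(5) obtain w where w: "w \<in> V" "y w \<noteq> 0"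
    and y: "\<And>u. u \<in> V \<Longrightarrow> (\<Sum>v\<in>V. A u v * y v) = \<mu> * y u"
    by (auto simp: eigenpair_def)
  have ne: "V \<noteq> {}" using w by auto
  define q where "q = Max ((\<lambda>v. \<bar>y v\<bar> / x v) ` V)"
  have le: "\<bar>y v\<bar> \<le> q * x v" if "v \<in> V" for v
  proof -
    have "\<bar>y v\<bar> / x v \<le> q" unfolding q_def using fin that by (intro Max_ge) auto
    then show ?thesis using x(1)[OF that] by (simp add: field_simps)
  qed
  have "q \<in> (\<lambda>v. \<bar>y v\<bar> / x v) ` V"
    unfolding q_def using fin ne by (intro Max_in) auto
  then obtain u where u: "u \<in> V" "q = \<bar>y u\<bar> / x u" by blast
  then have qu: "\<bar>y u\<bar> = q * x u" using x(1)[OF u(1)] by simp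
  have "0 < q * x w" using le[OF w(1)] w(2) by linarith
  then have q: "q > 0" using x(1)[OF w(1)] by (simp add: zero_less_mult_iff)
  have "\<mu> * (q * x u) \<le> \<bar>\<mu> * y u\<bar>"
    unfolding qu[symmetric] by (simp add: abs_mult mult_right_mono)
  also have "\<dots> = \<bar>\<Sum>v\<in>V. A u v * y v\<bar>" using y u by simp
  also have "\<dots> \<le> (\<Sum>v\<in>V. \<bar>A u v * y v\<bar>)" by (rule sum_abs)
  also have "\<dots> \<le> (\<Sum>v\<in>V. A u v * (q * x v))"
    using nonneg u(1) le by (intro sum_mono) (simp add: abs_mult mult_left_mono)
  also have "\<dots> = q * (\<Sum>v\<in>V. A u v * x v)" by (simp add: sum_distrib_left mult_ac)
  also have "\<dots> \<le> q * (c * x u)" using q x(2)[OF u(1)] by simp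
  finally have "\<mu> * (q * x u) \<le> c * (q * x u)" by (simp add: mult_ac)
  then show ?thesis
    using q x(1)[OF u(1)] by simp
qed

section \<open>Distance matrices and the secular equation\<close>

lemma walk_iff_successively:
  "walk G xs \<longleftrightarrow> xs \<noteq> [] \<and> set xs \<subseteq> gverts G \<and> successively (gadj G) xs"
  by (auto simp: walk_def successively_conv_nth)

lemma simple_graph_adj_commute: "simple_graph G \<Longrightarrow> gadj G u v = gadj G v u"
  by (auto simp: simple_graph_def)

lemma walk_rev: "simple_graph G \<Longrightarrow> walk G xs \<Longrightarrow> walk G (rev xs)"
  by (simp add: walk_iff_successively simple_graph_adj_commute)

lemma gdist_commute:
  assumes "simple_graph G"
  shows "gdist G u v = gdist G v u"
proof -
  have "\<exists>ys. walk G ys \<and> hd ys = w \<and> last ys = z \<and> length ys = Suc k"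
    if "walk G xs" "hd xs = z" "last xs = w" "length xs = Suc k" for xs w z k
    using that walk_rev[OF assms that(1)] by (intro exI[of _ "rev xs"]) (auto simp: hd_rev last_rev)
  then show ?thesis
    unfolding gdist_def by (intro arg_cong[where f = Least] ext) blast
qed

lemma gdist_le_walk:
  "walk G xs \<Longrightarrow> hd xs = u \<Longrightarrow> last xs = v \<Longrightarrow> length xs = Suc k \<Longrightarrow> gdist G u v \<le> k"
  unfolding gdist_def by (rule Least_le) blast

lemma gdist_self [simp]: "u \<in> gverts G \<Longrightarrow> gdist G u u = 0"
  using gdist_le_walk[of G "[u]" u u 0] by (simp add: walk_iff_successively)

lemma gdist_le_1: "simple_graph G \<Longrightarrow> gadj G u v \<Longrightarrow> gdist G u v \<le> 1"
  using gdist_le_walk[of G "[u, v]" u v 1] by (auto simp: walk_iff_successively simple_graph_def)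

lemma gdist_le_2: "simple_graph G \<Longrightarrow> gadj G u w \<Longrightarrow> gadj G w v \<Longrightarrow> gdist G u v \<le> 2"
  using gdist_le_walk[of G "[u, w, v]" u v 2] by (auto simp: walk_iff_successively simple_graph_def)

text \<open>Connectedness guarantees that the \<open>LEAST\<close> in \<open>gdist\<close> is
  attained by a walk. Distinct ends exclude the one-vertex walk, so a distance of at most 1 comes
  from a single edge.\<close>

lemma gdist_le_1D:
  assumes "connected_graph G" "u \<in> gverts G" "v \<in> gverts G" "u \<noteq> v" "gdist G u v \<le> 1"
  shows "gadj G u v" "gdist G u v = 1"
proof -
  have "\<exists>xs. walk G xs \<and> hd xs = u \<and> last xs = v"
    using assms by (auto simp: connected_graph_def reachable_def)
  then have "\<exists>k xs. walk G xs \<and> hd xs = u \<and> last xs = v \<and> length xs = Suc k"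
    by (metis walk_def length_greater_0_conv gr0_conv_Suc)
  from LeastI_ex[OF this] obtain xs where
    xs: "walk G xs" "hd xs = u" "last xs = v" "length xs = Suc (gdist G u v)"
    unfolding gdist_def by blast
  have "length xs \<noteq> Suc 0"
    using xs assms(4) by (auto simp: length_Suc_conv)
  with xs assms(5) show "gdist G u v = 1" by linarith
  with xs have "length xs = Suc (Suc 0)" by simp
  then show "gadj G u v"
    using xs by (auto simp: length_Suc_conv walk_iff_successively)
qed

section \<open>Upper and lower bounds for the largest distance eigenvalue\<close>

lemma dist_eigenvalues_eq:
  "dist_eigenvalues G = {\<mu>. \<exists>x. eigenpair (gverts G) (\<lambda>u v. real (gdist G u v)) \<mu> x}"
  by (simp add: dist_eigenvalues_def eigenpair_def)

lemma finite_dist_eigenvalues: "simple_graph G \<Longrightarrow> finite (dist_eigenvalues G)"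
  unfolding dist_eigenvalues_eq
  by (rule finite_symmetric_eigenvalues) (auto simp: simple_graph_def gdist_commute)

lemma max_dist_eigenvalue:
  assumes "simple_graph G" "gverts G \<noteq> {}"
  obtains \<mu> where "\<mu> \<in> dist_eigenvalues G"
    "\<And>y. quad_form (gverts G) (\<lambda>u v. real (gdist G u v)) y \<le> \<mu> * (\<Sum>v\<in>gverts G. (y v)\<^sup>2)"
proof -
  have "finite (gverts G)" using assms by (simp add: simple_graph_def)
  from symmetric_max_eigenpair[OF this assms(2), of "\<lambda>u v. real (gdist G u v)"]
    gdist_commute[OF assms(1)]
  obtain \<mu> x where "eigenpair (gverts G) (\<lambda>u v. real (gdist G u v)) \<mu> x"
    "\<And>y. quad_form (gverts G) (\<lambda>u v. real (gdist G u v)) y \<le> \<mu> * (\<Sum>v\<in>gverts G. (y v)\<^sup>2)"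
    by metis
  then show ?thesis using that unfolding dist_eigenvalues_eq by blast
qed

lemma rayleigh_le_dist_lambda1:
  assumes "simple_graph G" "gverts G \<noteq> {}"
  shows "quad_form (gverts G) (\<lambda>u v. real (gdist G u v)) y
    \<le> dist_lambda1 G * (\<Sum>v\<in>gverts G. (y v)\<^sup>2)"
proof -
  obtain \<mu> where \<mu>: "\<mu> \<in> dist_eigenvalues G"
    "quad_form (gverts G) (\<lambda>u v. real (gdist G u v)) y \<le> \<mu> * (\<Sum>v\<in>gverts G. (y v)\<^sup>2)"
    using max_dist_eigenvalue[OF assms] by metis
  have "\<mu> \<le> dist_lambda1 G"
    unfolding dist_lambda1_def using finite_dist_eigenvalues[OF assms(1)] \<mu>(1) by (rule Max_ge)
  then have "\<mu> * (\<Sum>v\<in>gverts G. (y v)\<^sup>2) \<le> dist_lambda1 G * (\<Sum>v\<in>gverts G. (y v)\<^sup>2)"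
    by (intro mult_right_mono sum_nonneg) auto
  with \<mu>(2) show ?thesis by linarith
qed

lemma dist_lambda1_le_of_supervector:
  assumes "simple_graph G" "gverts G \<noteq> {}"
    and "\<And>v. v \<in> gverts G \<Longrightarrow> x v > 0"
    and "\<And>u. u \<in> gverts G \<Longrightarrow> (\<Sum>v\<in>gverts G. real (gdist G u v) * x v) \<le> c * x u"
  shows "dist_lambda1 G \<le> c"
proof -
  have "dist_eigenvalues G \<noteq> {}"
    using max_dist_eigenvalue[OF assms(1,2)] by blast
  moreover have "\<mu> \<le> c" if "\<mu> \<in> dist_eigenvalues G" for \<mu>
    using that assms eigenvalue_le_of_supervector[of "gverts G" "\<lambda>u v. real (gdist G u v)" x c \<mu>]
    unfolding dist_eigenvalues_eq by (auto simp: simple_graph_def)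
  ultimately show ?thesis
    unfolding dist_lambda1_def using finite_dist_eigenvalues[OF assms(1)] by (subst Max_le_iff) auto
qed

section \<open>The comparison matrix of a cut and its Perron vector\<close>

text \<open>The distance matrix of the join of a complete graph on \<open>S\<close> with the disjoint union of
  complete graphs on the blocks of \<open>P\<close>.\<close>
definition block_dist :: "'a set \<Rightarrow> 'a set set \<Rightarrow> 'a \<Rightarrow> 'a \<Rightarrow> real" where
  "block_dist S P u v =
    (if u = v then 0 else if u \<in> S \<or> v \<in> S \<or> (\<exists>B\<in>P. u \<in> B \<and> v \<in> B) then 1 else 2)"

definition block_sum :: "real \<Rightarrow> 'a set set \<Rightarrow> real" where
  "block_sum L P = (\<Sum>B\<in>P. real (card B) / (L + real (card B)))"

text \<open>Solution of the eigenvalue equation for eigenvalue \<open>L - 1\<close>. Let T be the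
  sum of the entries and T' the sum over the vertices outside \<open>S\<close>. A row in a block of
  size b reads T + T' = (L + b) x, a row in \<open>S\<close> reads T = L x. Normalising T + T' = 1
  gives both formulas, and computing T' in two ways gives the secular equation. For a partition the
  union in the second case is the block of \<open>u\<close>.\<close>

definition block_vec :: "real \<Rightarrow> 'a set \<Rightarrow> 'a set set \<Rightarrow> 'a \<Rightarrow> real" where
  "block_vec L S P u = (if u \<in> S then 1 / (2 * L - real (card S))
     else 1 / (L + real (card (\<Union>{B \<in> P. u \<in> B}))))"

text \<open>Blocks need not be connected: all that the distance bound uses is that no edge joins two
  blocks.\<close>

definition separates :: "'a sgraph \<Rightarrow> 'a set \<Rightarrow> 'a set set \<Rightarrow> bool" where
  "separates G S P \<longleftrightarrow> S \<subseteq> gverts G \<and> partition_on (gverts G - S) P \<and>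
     (\<forall>u\<in>gverts G - S. \<forall>v\<in>gverts G - S. gadj G u v \<longrightarrow> (\<exists>B\<in>P. u \<in> B \<and> v \<in> B))"

lemma partition_on_block_eq:
  "partition_on A P \<Longrightarrow> B \<in> P \<Longrightarrow> C \<in> P \<Longrightarrow> u \<in> B \<Longrightarrow> u \<in> C \<Longrightarrow> B = C"
  by (auto simp: partition_on_def disjoint_def)

lemma partition_on_Union_containing:
  "partition_on A P \<Longrightarrow> B \<in> P \<Longrightarrow> u \<in> B \<Longrightarrow> \<Union>{C \<in> P. u \<in> C} = B"
  using partition_on_block_eq[of A P B] by blast

lemma sum_partition_on:
  assumes "finite A" "partition_on A P"
  shows "sum f A = (\<Sum>B\<in>P. sum f B)"
proof -
  have "\<forall>B\<in>P. finite B" "\<forall>B\<in>P. \<forall>C\<in>P. B \<noteq> C \<longrightarrow> B \<inter> C = {}"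
    using assms by (auto simp: partition_on_def disjoint_def intro: finite_subset[of _ "\<Union>P"])
  from sum.Union_disjoint[OF this, of f] show ?thesis
    using partition_onD1[OF assms(2)] by simp
qed

context
  fixes V S :: "'a set" and P :: "'a set set"
  assumes fin: "finite V" and S: "S \<subseteq> V" and P: "partition_on (V - S) P"
begin

lemma finite_blocks: "finite P" "B \<in> P \<Longrightarrow> finite B" "B \<in> P \<Longrightarrow> B \<subseteq> V - S" "B \<in> P \<Longrightarrow> card B > 0"
proof -
  show "finite P" using finite_elements[OF _ P] fin by blast
  show sub: "B \<subseteq> V - S" if "B \<in> P" for B using that partition_onD1[OF P] by blast
  show finB: "finite B" if "B \<in> P" for B using sub[OF that] fin finite_subset by blast
  show "card B > 0" if "B \<in> P" for B
    using finB[OF that] partition_onD3[OF P] that by (auto simp: card_gt_0_iff)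
qed

lemma block_exists: "u \<in> V \<Longrightarrow> u \<notin> S \<Longrightarrow> \<exists>B\<in>P. u \<in> B"
  using partition_onD1[OF P] by blast

lemma block_dist_row_S:
  assumes "u \<in> S"
  shows "(\<Sum>v\<in>V. block_dist S P u v * x v) = sum x V - x u"
proof -
  have "(\<Sum>v\<in>V. block_dist S P u v * x v) = (\<Sum>v\<in>V. x v - (if v = u then x v else 0))"
    using assms by (intro sum.cong refl) (auto simp: block_dist_def)
  then show ?thesis
    using assms S fin by (auto simp: sum_subtractf)
qed

lemma block_dist_row_block:
  assumes "B \<in> P" "u \<in> B"
  shows "(\<Sum>v\<in>V. block_dist S P u v * x v) = sum x V - x u + (sum x (V - S) - sum x B)"
proof -
  have *: "(\<exists>C\<in>P. u \<in> C \<and> v \<in> C) \<longleftrightarrow> v \<in> B" for v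
    using partition_on_block_eq[OF P] assms by blast
  have BV: "B \<subseteq> V - S" using finite_blocks assms by blast
  have restr: "sum x C = (\<Sum>v\<in>V. if v \<in> C then x v else 0)" if "C \<subseteq> V" for C
    using sum.inter_restrict[OF fin, of x C] that by (simp add: Int_absorb1)
  \<comment> \<open>Every vertex other than \<open>u\<close> counts once, and those outside both
    \<open>S\<close> and \<open>B\<close> count once more.\<close>
  have "(\<Sum>v\<in>V. block_dist S P u v * x v) =
      (\<Sum>v\<in>V. x v - (if v = u then x v else 0) + ((if v \<in> V - S then x v else 0) - (if v \<in> B then x v else 0)))"
    using assms BV by (intro sum.cong refl) (auto simp: block_dist_def *)
  also have "\<dots> = sum x V - x u + (sum x (V - S) - sum x B)"
    using BV assms fin by (subst (2 3) restr) (auto simp: sum_subtractf sum.distrib)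
  finally show ?thesis .
qed

lemma block_vec_eq: "B \<in> P \<Longrightarrow> u \<in> B \<Longrightarrow> block_vec L S P u = 1 / (L + real (card B))"
  using finite_blocks partition_on_Union_containing[OF P, of B u] by (auto simp: block_vec_def)

context
  fixes L :: real
  assumes L: "L > real (card S)"
begin

lemma block_vec_pos: "block_vec L S P u > 0"
  using L by (simp add: block_vec_def)

lemma sum_block_vec_block: "B \<in> P \<Longrightarrow> sum (block_vec L S P) B = real (card B) / (L + real (card B))"
  using block_vec_eq by simp

lemma sum_block_vec_blocks: "sum (block_vec L S P) (V - S) = block_sum L P"
  using fin by (subst sum_partition_on[OF _ P]) (simp_all add: sum_block_vec_block block_sum_def)

lemma sum_block_vec: "sum (block_vec L S P) V = real (card S) / (2 * L - real (card S)) + block_sum L P"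
  unfolding sum.subset_diff[OF S fin] sum_block_vec_blocks by (simp add: block_vec_def)

text \<open>\<open>block_vec\<close> is the Perron vector of \<open>block_dist\<close> as soon as the secular equation
  \<open>block_sum L P = (L - s) / (2 L - s)\<close> holds, with eigenvalue \<open>L - 1\<close>.\<close>
lemma block_dist_block_vec:
  assumes "u \<in> V"
  defines "\<delta> \<equiv> block_sum L P - (L - real (card S)) / (2 * L - real (card S))"
  shows "(\<Sum>v\<in>V. block_dist S P u v * block_vec L S P v)
    = (L - 1) * block_vec L S P u + (if u \<in> S then \<delta> else 2 * \<delta>)"
proof (cases "u \<in> S")
  case True
  have "(L - real (card S)) / (2 * L - real (card S)) = L / (2 * L - real (card S)) - real (card S) / (2 * L - real (card S))"
    by (simp add: diff_divide_distrib)
  then show ?thesis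
    using True unfolding block_dist_row_S[OF True] sum_block_vec \<delta>_def
    by (simp add: block_vec_def diff_divide_distrib)
next
  case False
  with assms obtain B where B: "B \<in> P" "u \<in> B" using block_exists by blast
  define p where "p = 1 / (2 * L - real (card S))"
  define q where "q = 1 / (L + real (card B))"
  have pq: "(2 * L - real (card S)) * p = 1" "(L + real (card B)) * q = 1"
    using L by (simp_all add: p_def q_def)
  \<comment> \<open>The row of a block vertex contains \<open>block_sum L P\<close> twice, in the
    total over \<open>V\<close> and in the total over \<open>V - S\<close>; a row in
    \<open>S\<close> contains it once. Hence the factor 2 on the defect.\<close>
  have "\<delta> = block_sum L P - (L - real (card S)) * p"
    "sum (block_vec L S P) V = real (card S) * p + block_sum L P"
    "sum (block_vec L S P) B = real (card B) * q" "block_vec L S P u = q"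
    using block_vec_eq[OF B] sum_block_vec sum_block_vec_block[OF B(1)]
    by (simp_all add: p_def q_def \<delta>_def)
  with pq False show ?thesis
    unfolding block_dist_row_block[OF B] sum_block_vec_blocks by (simp add: algebra_simps)
qed

end

text \<open>Each ordered pair of distinct vertices contributes 1, and each ordered pair from
  different blocks contributes 1 more.\<close>

lemma sum_block_dist:
  "(\<Sum>u\<in>V. \<Sum>v\<in>V. block_dist S P u v) =
    real (card V) * (real (card V) - 1) + (real (card (V - S)))\<^sup>2 - (\<Sum>B\<in>P. (real (card B))\<^sup>2)"
proof -
  have S': "(\<Sum>v\<in>V. block_dist S P u v) = real (card V) - 1" if "u \<in> S" for u
    using block_dist_row_S[OF that, of "\<lambda>_. 1"] by simp
  have B': "(\<Sum>v\<in>V. block_dist S P u v) = real (card V) - 1 + (real (card (V - S)) - real (card B))"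
    if "B \<in> P" "u \<in> B" for u B
    using block_dist_row_block[OF that, of "\<lambda>_. 1"] by simp
  have card: "(\<Sum>B\<in>P. real (card B)) = real (card (V - S))"
    using sum_partition_on[OF _ P, of "\<lambda>_. 1::real"] fin by simp
  have "(\<Sum>u\<in>V. \<Sum>v\<in>V. block_dist S P u v) =
      (\<Sum>B\<in>P. \<Sum>u\<in>B. \<Sum>v\<in>V. block_dist S P u v) + (\<Sum>u\<in>S. \<Sum>v\<in>V. block_dist S P u v)"
    using fin by (subst sum.subset_diff[OF S fin]) (simp add: sum_partition_on[OF _ P])
  also have "\<dots> = (\<Sum>B\<in>P. real (card B) * (real (card V) - 1 + (real (card (V - S)) - real (card B))))
      + real (card S) * (real (card V) - 1)"
    by (simp add: S' B' cong: sum.cong)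
  also have "(\<Sum>B\<in>P. real (card B) * (real (card V) - 1 + (real (card (V - S)) - real (card B)))) =
      (\<Sum>B\<in>P. real (card B)) * (real (card V) - 1 + real (card (V - S))) - (\<Sum>B\<in>P. (real (card B))\<^sup>2)"
    by (simp add: sum_distrib_right sum.distrib sum_subtractf power2_eq_square right_diff_distrib distrib_left)
  finally have *: "(\<Sum>u\<in>V. \<Sum>v\<in>V. block_dist S P u v) =
      real (card (V - S)) * (real (card V) - 1 + real (card (V - S))) - (\<Sum>B\<in>P. (real (card B))\<^sup>2)
      + real (card S) * (real (card V) - 1)"
    unfolding card .
  have "card V = card (V - S) + card S"
    using card_Diff_subset[OF finite_subset[OF S fin] S] card_mono[OF fin S] by simp
  then have "real (card V) = real (card (V - S)) + real (card S)" by simp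
  with * show ?thesis by (simp add: algebra_simps power2_eq_square)
qed

end

lemma block_dist_le_gdist:
  assumes "connected_graph G" "separates G S P" "u \<in> gverts G" "v \<in> gverts G"
  shows "block_dist S P u v \<le> real (gdist G u v)"
proof -
  have "gdist G u v \<ge> 1" if "u \<noteq> v"
    using gdist_le_1D(2)[OF assms(1,3,4) that] by linarith
  moreover have "gdist G u v \<ge> 2" if "u \<noteq> v" "u \<notin> S" "v \<notin> S" "\<not> (\<exists>B\<in>P. u \<in> B \<and> v \<in> B)"
  proof (rule ccontr)
    assume "\<not> gdist G u v \<ge> 2"
    then have "gadj G u v" using gdist_le_1D(1)[OF assms(1,3,4) that(1)] by linarith
    then show False using that assms(2-4) unfolding separates_def by blast
  qed
  ultimately show ?thesis by (auto simp: block_dist_def)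
qed

text \<open>The rigidity step. For the trial vector \<open>x\<close> the quadratic form of the
  distance matrix is \<open>(L - 1)\<close> times the squared norm plus a sum of nonnegative
  excesses. With \<open>dist_lambda1 G\<close> at most \<open>L - 1\<close> all excesses vanish, and
  since \<open>x\<close> is strictly positive this kills both the defect and every entrywise
  difference of the two matrices.\<close>

lemma dist_lambda1_secular_bound:
  assumes G: "simple_graph G" "connected_graph G" "separates G S P"
    and L: "L > real (card S)"
    and ge: "block_sum L P \<ge> (L - real (card S)) / (2 * L - real (card S))"
    and le: "dist_lambda1 G \<le> L - 1"
  shows "block_sum L P = (L - real (card S)) / (2 * L - real (card S))"
    and "\<And>u v. u \<in> gverts G \<Longrightarrow> v \<in> gverts G \<Longrightarrow> real (gdist G u v) = block_dist S P u v"
proof -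
  define V where "V = gverts G"
  define x where "x = block_vec L S P"
  define \<delta> where "\<delta> = block_sum L P - (L - real (card S)) / (2 * L - real (card S))"
  define D where "D = (\<lambda>u v. real (gdist G u v))"
  have fin: "finite V" and V: "S \<subseteq> V" "partition_on (V - S) P" and ne: "V \<noteq> {}"
    using G by (auto simp: simple_graph_def separates_def connected_graph_def V_def)
  have pos: "x u > 0" for u unfolding x_def using block_vec_pos[OF fin V L] .
  have DE: "block_dist S P u v \<le> D u v" if "u \<in> V" "v \<in> V" for u v
    using block_dist_le_gdist[OF G(2,3)] that by (simp add: V_def D_def)
  \<comment> \<open>The excess in row \<open>u\<close> has two nonnegative sources: distances
    exceeding \<open>block_dist\<close>, and the defect of the secular equation.\<close>
  define r where "r = (\<lambda>u. x u * ((\<Sum>v\<in>V. (D u v - block_dist S P u v) * x v) + (if u \<in> S then \<delta> else 2 * \<delta>)))"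
  have \<delta>: "\<delta> \<ge> 0" using ge by (simp add: \<delta>_def)
  have nn: "(D u v - block_dist S P u v) * x v \<ge> 0" if "u \<in> V" "v \<in> V" for u v
    using DE[OF that] pos[of v] by simp
  have r: "r u \<ge> 0" if "u \<in> V" for u
    unfolding r_def
    using pos[of u] \<delta> sum_nonneg[of V, OF nn[OF that]] by simp
  have "quad_form V D x = (\<Sum>u\<in>V. (L - 1) * (x u)\<^sup>2 + r u)"
    unfolding quad_form_def
  proof (intro sum.cong refl)
    fix u assume "u \<in> V"
    from block_dist_block_vec[OF fin V L this]
    have "(\<Sum>v\<in>V. D u v * x v) = (L - 1) * x u + (if u \<in> S then \<delta> else 2 * \<delta>) +
        (\<Sum>v\<in>V. (D u v - block_dist S P u v) * x v)"
      by (simp add: x_def \<delta>_def left_diff_distrib sum_subtractf)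
    then show "x u * (\<Sum>v\<in>V. D u v * x v) = (L - 1) * (x u)\<^sup>2 + r u"
      unfolding r_def by (simp only: distrib_left) (simp add: power2_eq_square)
  qed
  also have "\<dots> = (L - 1) * (\<Sum>u\<in>V. (x u)\<^sup>2) + sum r V"
    by (simp add: sum.distrib sum_distrib_left)
  finally have "(L - 1) * (\<Sum>u\<in>V. (x u)\<^sup>2) + sum r V \<le> dist_lambda1 G * (\<Sum>u\<in>V. (x u)\<^sup>2)"
    using rayleigh_le_dist_lambda1[OF G(1), of x] ne by (simp add: V_def D_def)
  moreover have "dist_lambda1 G * (\<Sum>u\<in>V. (x u)\<^sup>2) \<le> (L - 1) * (\<Sum>u\<in>V. (x u)\<^sup>2)"
    using le by (intro mult_right_mono sum_nonneg) auto
  ultimately have "sum r V \<le> 0" by linarith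
  then have "sum r V = 0" using sum_nonneg[of V r] r by (simp add: antisym)
  then have r0: "r u = 0" if "u \<in> V" for u
    using sum_nonneg_eq_0_iff[OF fin, of r] r that by blast
  have parts: "(\<Sum>v\<in>V. (D u v - block_dist S P u v) * x v) = 0 \<and> \<delta> = 0" if "u \<in> V" for u
  proof -
    have "(\<Sum>v\<in>V. (D u v - block_dist S P u v) * x v) \<ge> 0" using nn that by (intro sum_nonneg) auto
    with r0[OF that] pos[of u] \<delta> show ?thesis by (auto simp: r_def split: if_splits)
  qed
  with ne show "block_sum L P = (L - real (card S)) / (2 * L - real (card S))"
    by (auto simp: \<delta>_def)
  fix u v assume uv: "u \<in> gverts G" "v \<in> gverts G"
  then have "(D u v - block_dist S P u v) * x v = 0"
    using parts[of u] sum_nonneg_eq_0_iff[OF fin, of "\<lambda>v. (D u v - block_dist S P u v) * x v"] nn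
    by (auto simp: V_def)
  then show "real (gdist G u v) = block_dist S P u v"
    using pos[of v] by (simp add: D_def)
qed

text \<open>When the secular equation holds exactly, \<open>block_vec\<close> is an eigenvector of
  \<open>block_dist\<close>; for entrywise smaller distances it remains a supervector.\<close>

lemma dist_lambda1_le_secular:
  assumes G: "simple_graph G" "gverts G \<noteq> {}" "S \<subseteq> gverts G" "partition_on (gverts G - S) P"
    and L: "L > real (card S)"
    and eq: "block_sum L P = (L - real (card S)) / (2 * L - real (card S))"
    and le: "\<And>u v. u \<in> gverts G \<Longrightarrow> v \<in> gverts G \<Longrightarrow> real (gdist G u v) \<le> block_dist S P u v"
  shows "dist_lambda1 G \<le> L - 1"
proof (rule dist_lambda1_le_of_supervector[OF G(1,2)])
  have fin: "finite (gverts G)" using G by (simp add: simple_graph_def)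
  show pos: "block_vec L S P v > 0" for v by (rule block_vec_pos[OF fin G(3,4) L])
  fix u assume u: "u \<in> gverts G"
  have "(\<Sum>v\<in>gverts G. real (gdist G u v) * block_vec L S P v)
      \<le> (\<Sum>v\<in>gverts G. block_dist S P u v * block_vec L S P v)"
    using le u pos by (intro sum_mono mult_right_mono) (auto intro: less_imp_le)
  also have "\<dots> = (L - 1) * block_vec L S P u"
    unfolding block_dist_block_vec[OF fin G(3,4) L u] by (simp add: eq)
  finally show "(\<Sum>v\<in>gverts G. real (gdist G u v) * block_vec L S P v) \<le> (L - 1) * block_vec L S P u" .
qed

section \<open>Extremal block structure\<close>

context
  fixes P :: "'a set set" and N :: nat
  assumes finP: "finite P" and pos: "\<And>B. B \<in> P \<Longrightarrow> card B > 0"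
    and N: "(\<Sum>B\<in>P. card B) = N"
begin

lemma card_block_le: "B \<in> P \<Longrightarrow> card B + card P \<le> N + 1"
proof -
  assume B: "B \<in> P"
  have "(\<Sum>C\<in>P - {B}. 1) \<le> (\<Sum>C\<in>P - {B}. card C)"
    using pos by (intro sum_mono) (auto simp: Suc_le_eq)
  then have "card P - 1 \<le> (\<Sum>C\<in>P - {B}. card C)"
    using B finP by (simp add: card_Diff_singleton)
  moreover have "N = card B + (\<Sum>C\<in>P - {B}. card C)"
    unfolding N[symmetric] using B finP by (rule sum.remove[rotated])
  ultimately show ?thesis by linarith
qed

text \<open>The summand is concave in the block size, hence lies above its chord over \<open>[1, N - j + 1]\<close>.\<close>
lemma block_sum_ge:
  fixes L :: real
  assumes L: "L > 0" and j: "1 \<le> j" "j \<le> card P"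
  defines "M \<equiv> real N - real j + 1"
  shows "M / (L + M) + (real j - 1) / (L + 1) \<le> block_sum L P"
    and "block_sum L P = M / (L + M) + (real j - 1) / (L + 1) \<Longrightarrow>
      card P = j \<and> (\<exists>B\<in>P. real (card B) = M)"
proof -
  \<comment> \<open>Slope of the chord of \<open>b / (L + b)\<close> between b = 1 and b =
    M.\<close>
  define \<kappa> where "\<kappa> = L / ((L + M) * (L + 1))"
  obtain B' where "B' \<in> P" using j by fastforce
  then have M1: "M \<ge> 1"
    using card_block_le[of B'] pos[of B'] j unfolding M_def by linarith
  have bM: "1 \<le> real (card B) \<and> real (card B) \<le> M" if "B \<in> P" for B
    using card_block_le[OF that] pos[OF that] j unfolding M_def by linarith
  \<comment> \<open>Height above the chord. The factored form shows that it vanishes only for block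
    sizes 1 and \<open>M\<close>, which settles the equality case.\<close>
  define d where "d = (\<lambda>B :: 'a set. real (card B) / (L + real (card B)) - 1 / (L + 1) - (real (card B) - 1) * \<kappa>)"
  have d: "d B = L * (real (card B) - 1) * (M - real (card B)) / ((L + real (card B)) * (L + 1) * (L + M))"
    if "B \<in> P" for B
  proof -
    have "L + real (card B) > 0" "L + 1 > 0" "L + M > 0" using bM[OF that] M1 L by auto
    then show ?thesis unfolding d_def \<kappa>_def by (simp add: divide_simps) (simp add: algebra_simps)
  qed
  have d0: "d B \<ge> 0" if "B \<in> P" for B
    unfolding d[OF that] using bM[OF that] M1 L by (intro divide_nonneg_nonneg mult_nonneg_nonneg) auto
  \<comment> \<open>Gain from having more than \<open>j\<close> blocks: along the chord each further
    block adds the intercept \<open>1 / (L + 1) - \<kappa>\<close>, which is positive.\<close>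
  define e where "e = (real (card P) - real j) * (1 / (L + 1) - \<kappa>)"
  have "\<kappa> = (L / (L + M)) * (1 / (L + 1))" by (simp add: \<kappa>_def)
  also have "\<dots> < 1 * (1 / (L + 1))"
    using L M1 by (intro mult_strict_right_mono) auto
  finally have \<kappa>: "1 / (L + 1) - \<kappa> > 0" by simp
  have e0: "e \<ge> 0" unfolding e_def using \<kappa> j by simp
  have chord: "M / (L + M) = 1 / (L + 1) + (M - 1) * \<kappa>"
    unfolding \<kappa>_def using L M1 by (simp add: divide_simps) (simp add: algebra_simps)
  have NM: "real N = M + real j - 1" by (simp add: M_def)
  have "block_sum L P = (\<Sum>B\<in>P. 1 / (L + 1) + (real (card B) - 1) * \<kappa> + d B)"
    unfolding block_sum_def d_def by (intro sum.cong) auto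
  also have "\<dots> = real (card P) / (L + 1) + ((\<Sum>B\<in>P. real (card B)) - real (card P)) * \<kappa> + sum d P"
    by (simp add: sum.distrib sum_distrib_right[symmetric] sum_subtractf)
  also have "(\<Sum>B\<in>P. real (card B)) = real N" using N by (metis of_nat_sum)
  finally have eq: "block_sum L P = M / (L + M) + (real j - 1) / (L + 1) + e + sum d P"
    unfolding chord e_def NM by (simp add: algebra_simps diff_divide_distrib)
  have sd: "sum d P \<ge> 0" using d0 by (rule sum_nonneg)
  with eq e0 show "M / (L + M) + (real j - 1) / (L + 1) \<le> block_sum L P" by linarith
  assume "block_sum L P = M / (L + M) + (real j - 1) / (L + 1)"
  with eq e0 sd have z: "e = 0" "sum d P = 0" by linarith+
  then have card: "card P = j" using \<kappa> by (simp add: e_def)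
  have "d B = 0" if "B \<in> P" for B
    using z(2) d0 finP that by (simp add: sum_nonneg_eq_0_iff)
  then have or: "real (card B) = 1 \<or> real (card B) = M" if "B \<in> P" for B
    using d[OF that] L bM[OF that] that by auto
  have "\<exists>B\<in>P. real (card B) = M"
  proof (rule ccontr)
    assume neg: "\<not> ?thesis"
    \<comment> \<open>With singletons only, \<open>N = j\<close> and so \<open>M = 1\<close>; any
      block then has size \<open>M\<close> after all.\<close>
    then have "(\<Sum>B\<in>P. card B) = (\<Sum>B\<in>P. 1)" using or by (intro sum.cong refl) fastforce
    then have "M = 1" using N card by (simp add: M_def)
    with neg or \<open>B' \<in> P\<close> show False by blast
  qed
  with card show "card P = j \<and> (\<exists>B\<in>P. real (card B) = M)" by blast
qed

text \<open>Convexity this time: on [1, M] the square lies below its chord, whose slope is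
  \<open>M + 1\<close>.\<close>

lemma sum_card_squares_le:
  assumes "P \<noteq> {}"
  shows "(\<Sum>B\<in>P. (real (card B))\<^sup>2) \<le> (real N - real (card P) + 1)\<^sup>2 + (real (card P) - 1)"
proof -
  define M where "M = real N - real (card P) + 1"
  have "(\<Sum>B\<in>P. (real (card B))\<^sup>2) \<le> (\<Sum>B\<in>P. 1 + (real (card B) - 1) * (M + 1))"
  proof (rule sum_mono)
    fix B assume B: "B \<in> P"
    have "1 \<le> real (card B)" "real (card B) \<le> M"
      using card_block_le[OF B] pos[OF B] unfolding M_def by linarith+
    then have "0 \<le> (real (card B) - 1) * (M - real (card B))" by simp
    then show "(real (card B))\<^sup>2 \<le> 1 + (real (card B) - 1) * (M + 1)"
      by (simp add: algebra_simps power2_eq_square)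
  qed
  also have "\<dots> = real (card P) + ((\<Sum>B\<in>P. real (card B)) - real (card P)) * (M + 1)"
    by (simp add: sum.distrib sum_distrib_right[symmetric] sum_subtractf)
  also have "(\<Sum>B\<in>P. real (card B)) = real N" using N by (metis of_nat_sum)
  finally show ?thesis by (simp add: M_def algebra_simps power2_eq_square)
qed

end

text \<open>The join of a clique on \<open>S\<close> with a clique plus isolated vertices
  \<open>W\<close>, described inside an arbitrary vertex type. Both extremal graphs, built on nested
  sum types, and the graph \<open>G\<close> can thus be recognised by one predicate, and three
  cardinalities determine the isomorphism type.\<close>

definition join_clique_isolated :: "'a sgraph \<Rightarrow> 'a set \<Rightarrow> 'a set \<Rightarrow> bool" where
  "join_clique_isolated G S W \<longleftrightarrow> S \<subseteq> gverts G \<and> W \<subseteq> gverts G \<and> S \<inter> W = {} \<and>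
     (\<forall>u\<in>gverts G. \<forall>v\<in>gverts G.
        gadj G u v \<longleftrightarrow> u \<noteq> v \<and> (u \<in> S \<or> v \<in> S \<or> (u \<notin> W \<and> v \<notin> W)))"

lemma graph_iso_join_clique_isolated:
  assumes G: "join_clique_isolated G S W" "finite (gverts G)"
    and H: "join_clique_isolated H S' W'" "finite (gverts H)"
    and card: "card (gverts G) = card (gverts H)" "card S = card S'" "card W = card W'"
  shows "graph_iso G H"
proof -
  let ?R = "gverts G - (S \<union> W)" and ?R' = "gverts H - (S' \<union> W')"
  have sub: "S \<subseteq> gverts G" "W \<subseteq> gverts G" "S \<inter> W = {}"
    "S' \<subseteq> gverts H" "W' \<subseteq> gverts H" "S' \<inter> W' = {}"
    using G(1) H(1) by (auto simp: join_clique_isolated_def)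
  have fin: "finite S" "finite W" "finite S'" "finite W'"
    using sub G(2) H(2) finite_subset by blast+
  have "card ?R = card ?R'"
    using sub fin card by (simp add: card_Diff_subset card_Un_disjoint)
  then obtain f3 where f3: "bij_betw f3 ?R ?R'"
    using G(2) H(2) finite_same_card_bij[of ?R ?R'] by auto
  obtain f1 where f1: "bij_betw f1 S S'" using finite_same_card_bij[OF fin(1,3) card(2)] by auto
  obtain f2 where f2: "bij_betw f2 W W'" using finite_same_card_bij[OF fin(2,4) card(3)] by auto
  define f where "f = (\<lambda>v. if v \<in> S then f1 v else if v \<in> W then f2 v else f3 v)"
  have b1: "bij_betw f S S'"
    using f1 by (rule bij_betw_cong[THEN iffD1, rotated]) (simp add: f_def)
  have b2: "bij_betw f W W'"
    using f2 by (rule bij_betw_cong[THEN iffD1, rotated]) (use sub in \<open>auto simp: f_def\<close>)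
  have b3: "bij_betw f ?R ?R'"
    using f3 by (rule bij_betw_cong[THEN iffD1, rotated]) (simp add: f_def)
  have "bij_betw f (S \<union> W \<union> ?R) (S' \<union> W' \<union> ?R')"
    using b1 b2 b3 sub by (intro bij_betw_combine) auto
  moreover have "S \<union> W \<union> ?R = gverts G" "S' \<union> W' \<union> ?R' = gverts H" using sub by auto
  ultimately have b: "bij_betw f (gverts G) (gverts H)" by simp
  have S: "f v \<in> S' \<longleftrightarrow> v \<in> S" and W: "f v \<in> W' \<longleftrightarrow> v \<in> W" if "v \<in> gverts G" for v
  proof -
    have "f v \<in> f ` C \<longleftrightarrow> v \<in> C" if "C \<subseteq> gverts G" for C
      using \<open>v \<in> gverts G\<close> that b by (intro inj_on_image_mem_iff) (auto simp: bij_betw_def)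
    then show "f v \<in> S' \<longleftrightarrow> v \<in> S" "f v \<in> W' \<longleftrightarrow> v \<in> W"
      using sub b1 b2 by (metis bij_betw_imp_surj_on)+
  qed
  have "gadj G u v \<longleftrightarrow> gadj H (f u) (f v)" if "u \<in> gverts G" "v \<in> gverts G" for u v
  proof -
    have "f u \<in> gverts H" "f v \<in> gverts H" "f u = f v \<longleftrightarrow> u = v"
      using b that by (auto simp: bij_betw_def inj_on_def)
    then show ?thesis
      using G(1) H(1) that S W by (simp add: join_clique_isolated_def)
  qed
  with b show ?thesis unfolding graph_iso_def by blast
qed

lemma sum_card_blocks:
  assumes "finite V" "partition_on (V - S) P"
  shows "(\<Sum>B\<in>P. card B) = card (V - S)"
  using sum_partition_on[OF _ assms(2), of "\<lambda>_. 1::nat"] assms(1) by simp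

text \<open>One block of the largest possible size forces all other blocks to be singletons, and
  these form \<open>W\<close>. Adjacency is then read off as distance at most 1.\<close>

lemma join_clique_isolated_of_extremal_blocks:
  assumes G: "simple_graph G" "connected_graph G" "separates G S P"
    and dist: "\<And>u v. u \<in> gverts G \<Longrightarrow> v \<in> gverts G \<Longrightarrow> real (gdist G u v) = block_dist S P u v"
    and B: "B \<in> P" "card B + card P = card (gverts G - S) + 1"
  shows "\<exists>W. join_clique_isolated G S W \<and> Suc (card W) = card P"
proof -
  define V where "V = gverts G"
  have fin: "finite V" and S: "S \<subseteq> V" and P: "partition_on (V - S) P"
    using G by (auto simp: simple_graph_def separates_def V_def)
  note blocks = finite_blocks[OF fin S P]
  define W where "W = V - S - B"
  have Bsub: "B \<subseteq> V - S" using blocks B by blast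
  have cW: "Suc (card W) = card P"
    using B(2) Bsub blocks(2)[OF B(1)] card_mono[OF finite_Diff[OF fin] Bsub]
    by (simp add: W_def card_Diff_subset V_def)
  have "(\<Sum>C\<in>P - {B}. card C) = card (P - {B})"
    using sum.remove[OF blocks(1) B(1), of card] sum_card_blocks[OF fin P] B blocks(1) by (simp add: V_def)
  then have "(\<Sum>C\<in>P - {B}. card C - 1) = 0"
    using blocks(4) by (subst sum_subtractf_nat) (auto simp: Suc_le_eq)
  then have "\<forall>C\<in>P - {B}. card C - 1 = 0" using blocks(1) by (subst (asm) sum_eq_0_iff) auto
  then have one: "card C = 1" if "C \<in> P" "C \<noteq> B" for C
    using that(2) blocks(4)[OF that(1)] that(1) by (metis Diff_iff One_nat_def Suc_pred singletonD)
  have same: "(\<exists>C\<in>P. u \<in> C \<and> v \<in> C) \<longleftrightarrow> u \<notin> W \<and> v \<notin> W"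
    if "u \<in> V" "v \<in> V" "u \<notin> S" "v \<notin> S" "u \<noteq> v" for u v
  proof
    assume "\<exists>C\<in>P. u \<in> C \<and> v \<in> C"
    then obtain C where C: "C \<in> P" "u \<in> C" "v \<in> C" by blast
    then have "C = B" using one[of C] that(5) by (auto simp: card_1_singleton_iff)
    with C show "u \<notin> W \<and> v \<notin> W" by (simp add: W_def)
  qed (use B that in \<open>auto simp: W_def\<close>)
  have "gadj G u v \<longleftrightarrow> u \<noteq> v \<and> (u \<in> S \<or> v \<in> S \<or> (u \<notin> W \<and> v \<notin> W))"
    if uv: "u \<in> V" "v \<in> V" for u v
  proof (cases "u = v")
    case True
    then show ?thesis using G(1) by (auto simp: simple_graph_def)
  next
    case False
    have "gadj G u v \<longleftrightarrow> gdist G u v \<le> 1"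
      using gdist_le_1[OF G(1)] gdist_le_1D(1)[OF G(2)] uv False by (auto simp: V_def)
    also have "\<dots> \<longleftrightarrow> block_dist S P u v \<le> 1"
      using dist[of u v] uv by (metis V_def of_nat_1 of_nat_le_iff)
    also have "\<dots> \<longleftrightarrow> u \<in> S \<or> v \<in> S \<or> (u \<notin> W \<and> v \<notin> W)"
      using same[OF uv] False by (auto simp: block_dist_def)
    finally show ?thesis using False by simp
  qed
  moreover have "W \<subseteq> V" "S \<inter> W = {}" by (auto simp: W_def)
  ultimately show ?thesis
    using S cW unfolding join_clique_isolated_def V_def by blast
qed

text \<open>A vertex of the nonempty set \<open>S\<close> is adjacent to all others, so no distance
  exceeds 2 and \<open>block_dist\<close> bounds the metric from above.\<close>

lemma dist_lambda1_join_clique_isolated_le: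
  assumes G: "simple_graph G" "join_clique_isolated G S W"
    and card: "card (gverts G) = card S + m + card W" "card S \<ge> 1" "m \<ge> 1"
    and L: "L > real (card S)"
    and eq: "real m / (L + real m) + real (card W) / (L + 1)
      = (L - real (card S)) / (2 * L - real (card S))"
  shows "dist_lambda1 G \<le> L - 1"
proof -
  define V where "V = gverts G"
  define R where "R = V - S - W"
  define P where "P = insert R ((\<lambda>w. {w}) ` W)"
  have fin: "finite V" using G by (simp add: simple_graph_def V_def)
  have sub: "S \<subseteq> V" "W \<subseteq> V" "S \<inter> W = {}"
    and adj: "\<And>u v. u \<in> V \<Longrightarrow> v \<in> V \<Longrightarrow>
      gadj G u v \<longleftrightarrow> u \<noteq> v \<and> (u \<in> S \<or> v \<in> S \<or> (u \<notin> W \<and> v \<notin> W))"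
    using G(2) by (auto simp: join_clique_isolated_def V_def)
  have finS: "finite S" "finite W" using fin sub finite_subset by blast+
  have "R = V - (S \<union> W)" by (auto simp: R_def)
  then have cR: "card R = m"
    using card(1) sub finS by (simp add: card_Diff_subset card_Un_disjoint V_def)
  then have Rne: "R \<noteq> {}" using card(3) by auto
  have P: "partition_on (V - S) P"
    using sub Rne by (auto simp: partition_on_def disjoint_def P_def R_def)
  have "R \<notin> (\<lambda>w. {w}) ` W" using Rne by (auto simp: R_def)
  then have "block_sum L P = real m / (L + real m) + real (card W) / (L + 1)"
    unfolding block_sum_def P_def using finS by (simp add: cR sum.reindex)
  with eq have eq': "block_sum L P = (L - real (card S)) / (2 * L - real (card S))" by simp
  obtain w where w: "w \<in> S" using card(2) by fastforce
  have dist: "real (gdist G u v) \<le> block_dist S P u v" if uv: "u \<in> V" "v \<in> V" for u v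
  proof (cases "u = v")
    case True
    then show ?thesis using uv by (simp add: V_def block_dist_def)
  next
    case False
    show ?thesis
    proof (cases "gadj G u v")
      case True
      then have "gdist G u v \<le> 1" using G(1) by (rule gdist_le_1[rotated])
      then show ?thesis using False by (auto simp: block_dist_def)
    next
      case nadj: False
      then have ns: "u \<notin> S" "v \<notin> S" "u \<in> W \<or> v \<in> W" using adj uv False by auto
      then have "gadj G u w" "gadj G w v" using adj uv sub w by auto
      then have "gdist G u v \<le> 2" by (rule gdist_le_2[OF G(1)])
      moreover have "\<not> (\<exists>B\<in>P. u \<in> B \<and> v \<in> B)"
        using ns False by (auto simp: P_def R_def)
      ultimately show ?thesis using ns False by (auto simp: block_dist_def)
    qed
  qed
  have "V \<noteq> {}" using sub w by auto
  with dist_lambda1_le_secular[OF G(1), of S P L] sub P L eq' dist show ?thesis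
    unfolding V_def by blast
qed

text \<open>Intermediate values on [n, 3n]. At n both denominators on the left are at most
  \<open>2 * n - s\<close> and the numerators add up to \<open>n - s\<close>; at 3n the left side is
  at most 1/3 and the right side at least 1/3.\<close>

lemma secular_root_exists:
  fixes s m k n :: real
  assumes "s \<ge> 0" "m \<ge> 1" "k \<ge> 0" "n = s + m + k"
  obtains L where "n \<le> L" "m / (L + m) + k / (L + 1) = (L - s) / (2 * L - s)"
proof -
  define F where "F = (\<lambda>L. m / (L + m) + k / (L + 1) - (L - s) / (2 * L - s))"
  have "\<exists>L. n \<le> L \<and> L \<le> 3 * n \<and> F L = 0"
  proof (rule IVT2')
    have "(3 * n - s) / (2 * (3 * n) - s) \<ge> 1 / 3" using assms by (simp add: field_simps)
    moreover have "m / (3 * n + m) \<le> m / (3 * n)" "k / (3 * n + 1) \<le> k / (3 * n)"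
      using assms by (auto intro!: divide_left_mono mult_pos_pos)
    moreover have "m / (3 * n) + k / (3 * n) \<le> 1 / 3"
      unfolding add_divide_distrib[symmetric] using assms by (simp add: divide_le_eq)
    ultimately show "F (3 * n) \<le> 0" unfolding F_def by linarith
    have "m / (n + m) \<ge> m / (2 * n - s)" "k / (n + 1) \<ge> k / (2 * n - s)"
      using assms by (auto intro!: divide_left_mono mult_pos_pos)
    moreover have "m / (2 * n - s) + k / (2 * n - s) = (n - s) / (2 * n - s)"
      using assms by (simp add: add_divide_distrib)
    ultimately show "0 \<le> F n" by (simp add: F_def)
    show "n \<le> 3 * n" using assms by simp
    show "continuous_on {n..3 * n} F"
      unfolding F_def using assms by (intro continuous_intros) auto
  qed
  then show ?thesis using that by (auto simp: F_def)
qed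

section \<open>Numerical estimates\<close>

lemma complement_fractions:
  fixes L a s :: real
  assumes "L > 0" "a \<ge> 0" "s < L"
  shows "a / (L + a) = 1 - L / (L + a)" "(L - s) / (2 * L - s) = 1 - L / (2 * L - s)"
  using assms by (simp_all add: field_simps)

text \<open>Exchanging \<open>S\<close> of size 1 and \<open>k\<close> isolated vertices for \<open>S\<close> of size \<open>s\<close> and \<open>k s\<close> isolated
  vertices makes the left-hand side of the secular equation too large.\<close>
lemma secular_strict_reciprocal:
  fixes k s n m u L :: real
  assumes k: "k \<ge> 1" and s: "s \<ge> 2" and n: "n \<ge> s + k * s + 1" "2 * n \<ge> 9 * k + 9"
    and L: "L \<ge> n" and m: "m = n - 1 - k" and u: "u = n - s - k * s"
    and eq: "m / (L + m) + k / (L + 1) = (L - 1) / (2 * L - 1)"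
  shows "u / (L + u) + k * s / (L + 1) > (L - s) / (2 * L - s)"
proof -
  have "k * s > 0" using k s by simp
  then have pos: "L \<ge> 9" "m \<ge> 7 / 2 * (k + 1)" "u \<ge> 1" "s < L" "m > 0"
    using n L k m u by auto
  \<comment> \<open>Exactly what is needed to replace \<open>L * (k + 1) / (L + m)\<close> by
    \<open>k + 1 / 4\<close>. If it failed, the left side of the secular equation would be below 3/8
    + 6/70, less than 8/17, the value of the right side at L = 9. The assumption
    \<open>2 * n \<ge> 9 * k + 9\<close> supplies both \<open>L \<ge> 9\<close> and
    \<open>m \<ge> 7 / 2 * (k + 1)\<close>.\<close>
  have Lm: "3 * L \<le> (4 * k + 1) * m"
  proof (rule ccontr)
    assume neg: "\<not> ?thesis"
    have "m / (L + m) < 3 / 8"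
    proof -
      have "5 * m \<le> (4 * k + 1) * m" using k pos by (intro mult_right_mono) auto
      with neg have "5 * m < 3 * L" by linarith
      then show ?thesis using pos by (simp add: field_simps)
    qed
    moreover have "k / (L + 1) \<le> 6 / 70"
    proof -
      have "(4 * k - 1) * (k - 1) \<ge> 0" using k by simp
      then have "10 * k \<le> (4 * k + 1) * (k + 1)" by (simp add: algebra_simps)
      then have "35 * k \<le> (4 * k + 1) * (7 / 2 * (k + 1))" by (simp add: algebra_simps)
      also have "\<dots> \<le> (4 * k + 1) * m" using k pos by (intro mult_left_mono) auto
      finally have "35 * k < 3 * L" using neg by linarith
      then show ?thesis using pos by (simp add: field_simps)
    qed
    moreover have "(L - 1) / (2 * L - 1) \<ge> 8 / 17" using pos by (simp add: field_simps)
    ultimately show False using eq by linarith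
  qed
  \<comment> \<open>Change of the defect between cut sizes 1 and \<open>s\<close>, divided by
    \<open>s - 1\<close>: gain from new isolated vertices, gain from the right side, loss from the
    shrinking clique. The loss exceeds the first gain by at most \<open>1 / (4 * (L + 1))\<close>,
    which the second gain covers.\<close>
  define \<Delta> where "\<Delta> = k / (L + 1) + L / ((2 * L - s) * (2 * L - 1)) - L * (k + 1) / ((L + u) * (L + m))"
  have "L * (k + 1) / ((L + u) * (L + m)) \<le> L * (k + 1) / ((L + 1) * (L + m))"
    using pos k by (intro divide_left_mono mult_right_mono mult_nonneg_nonneg mult_pos_pos) auto
  also have "\<dots> \<le> (k + 1 / 4) / (L + 1)"
  proof -
    have "(k + 1 / 4) * (L + m) - L * (k + 1) = ((4 * k + 1) * m - 3 * L) / 4"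
      by (simp add: field_simps)
    with Lm have "L * (k + 1) \<le> (k + 1 / 4) * (L + m)" by simp
    then have "L * (k + 1) / (L + m) \<le> k + 1 / 4" using pos by (simp add: divide_le_eq)
    then have "L * (k + 1) / (L + m) / (L + 1) \<le> (k + 1 / 4) / (L + 1)"
      using pos by (intro divide_right_mono) auto
    then show ?thesis by (simp add: mult.commute)
  qed
  finally have 1: "L * (k + 1) / ((L + u) * (L + m)) \<le> k / (L + 1) + 1 / (4 * (L + 1))"
    by (simp add: add_divide_distrib)
  have "(2 * L - s) * (2 * L - 1) < (2 * L) * (2 * L)"
    using pos s by (intro mult_strict_mono) auto
  then have "(2 * L - s) * (2 * L - 1) < L * (4 * (L + 1))" using pos by (simp add: algebra_simps)
  moreover have "(2 * L - s) * (2 * L - 1) > 0" using pos by simp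
  ultimately have 2: "1 / (4 * (L + 1)) < L / ((2 * L - s) * (2 * L - 1))"
    using pos by (subst frac_less_eq) (auto simp: divide_simps)
  from 1 2 have "\<Delta> > 0" unfolding \<Delta>_def by linarith
  then have \<Delta>: "(s - 1) * \<Delta> > 0" using s by simp
  have um: "m - u = (s - 1) * (k + 1)" by (simp add: m u algebra_simps)
  have "L / (L + m) - L / (L + u) = - (L * (m - u) / ((L + u) * (L + m)))"
    using pos by (simp add: divide_simps) (simp add: algebra_simps)
  moreover have "L / (2 * L - s) - L / (2 * L - 1) = (s - 1) * (L / ((2 * L - s) * (2 * L - 1)))"
    using pos by (simp add: divide_simps) (simp add: algebra_simps)
  ultimately have "(s - 1) * \<Delta> = k * s / (L + 1) - k / (L + 1)
      + (L / (2 * L - s) - L / (2 * L - 1)) + (L / (L + m) - L / (L + u))"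
    unfolding \<Delta>_def um by (simp add: algebra_simps diff_divide_distrib)
  with \<Delta> eq complement_fractions[of L m 1] complement_fractions[of L u s] pos
  show ?thesis by linarith
qed

text \<open>In this form \<open>L - s - m\<close> is constant as long as the order
  \<open>s + m + 1\<close> is fixed, so varying \<open>s\<close> only affects the product
  \<open>(L + m) * (2 * L - s)\<close>.\<close>

lemma secular_single_isolated_diff:
  fixes L m s :: real
  assumes "L > s" "m \<ge> 0" "L > 0"
  shows "m / (L + m) + 1 / (L + 1) - (L - s) / (2 * L - s) =
    ((L + m) * (2 * L - s) - L * (L + 1) * (L - s - m)) / ((L + 1) * (L + m) * (2 * L - s))"
proof -
  have "L + m \<noteq> 0" "L + 1 \<noteq> 0" "2 * L - s \<noteq> 0" using assms by auto
  then show ?thesis by (simp add: divide_simps) (simp add: algebra_simps)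
qed

lemma secular_single_isolated_root:
  fixes L m s n :: real
  assumes "n = s + m + 1" "s \<ge> 1" "m \<ge> 1" "L \<ge> n"
    and eq: "m / (L + m) + 1 / (L + 1) = (L - s) / (2 * L - s)"
  shows "L < n + 3"
    and "s' < s \<Longrightarrow> s' \<ge> 0 \<Longrightarrow> (n - s' - 1) / (L + (n - s' - 1)) + 1 / (L + 1) > (L - s') / (2 * L - s')"
proof -
  have "(L + 1) * (L + m) * (2 * L - s) > 0" using assms by simp
  with eq secular_single_isolated_diff[of s L m] assms
  have poly: "(L + m) * (2 * L - s) = L * (L + 1) * (L - s - m)" by auto
  show "L < n + 3"
  proof (rule ccontr)
    assume "\<not> L < n + 3"
    then have "L * (L + 1) * 4 \<le> L * (L + 1) * (L - s - m)"
      using assms by (intro mult_left_mono) auto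
    moreover have "(L + m) * (2 * L - s) < (2 * L) * (2 * L)"
      using assms by (intro mult_strict_mono) auto
    ultimately show False using poly assms by (simp add: algebra_simps)
  qed
  assume s': "s' < s" "s' \<ge> 0"
  \<comment> \<open>Passing to the smaller \<open>s'\<close> enlarges both factors, while the
    subtracted term keeps its value at the root.\<close>
  have "(L + m) * (2 * L - s) < (L + (n - s' - 1)) * (2 * L - s')"
    using assms s' by (intro mult_strict_mono) auto
  then have "0 < (L + (n - s' - 1)) * (2 * L - s') - L * (L + 1) * (L - s' - (n - s' - 1))"
    using poly assms(1) by (simp add: diff_diff_eq add_ac)
  moreover have "(L + 1) * (L + (n - s' - 1)) * (2 * L - s') > 0" using assms s' by simp
  ultimately have "0 < ((L + (n - s' - 1)) * (2 * L - s') - L * (L + 1) * (L - s' - (n - s' - 1)))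
      / ((L + 1) * (L + (n - s' - 1)) * (2 * L - s'))"
    by (rule divide_pos_pos)
  then show "(n - s' - 1) / (L + (n - s' - 1)) + 1 / (L + 1) > (L - s') / (2 * L - s')"
    using secular_single_isolated_diff[of s' L "n - s' - 1"] assms s' by simp
qed

text \<open>The left side bounds from below the number of ordered pairs in different blocks; 3n of
  them lift the average row sum from n - 1 to n + 2.\<close>

lemma nonadjacent_pairs_bound:
  fixes c s n t :: real
  assumes t: "t \<ge> 1" and n: "n \<ge> 4 * t\<^sup>2 + 10 * t" and c: "c \<ge> 3"
    and s: "s \<le> t * c - 1" "s + c \<le> n"
  shows "(c - 1) * (2 * (n - s) - c) \<ge> 3 * n"
proof -
  have t2: "t\<^sup>2 \<ge> t" using t by (simp add: power2_eq_square)
  \<comment> \<open>The cap \<open>n - c\<close> on \<open>s\<close> takes over from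
    \<open>t * c - 1\<close> at \<open>c * (t + 1) = n + 1\<close>. Below that point,
    \<open>c \<ge> 3 * t + 4\<close> makes the first factor at least \<open>3 * (t + 1)\<close>; for
    smaller \<open>c\<close> the product is expanded around c = 3.\<close>
  consider "c * (t + 1) \<ge> n + 1" | "c * (t + 1) < n + 1" "c \<ge> 3 * t + 4" | "c < 3 * t + 4" by linarith
  then show ?thesis
  proof cases
    case 1
    have "3 * (t + 1) \<le> c - 1"
    proof (rule ccontr)
      assume "\<not> ?thesis"
      then have "c * (t + 1) \<le> (3 * t + 4) * (t + 1)" using t by (intro mult_right_mono) auto
      also have "\<dots> = 3 * t\<^sup>2 + 7 * t + 4" by (simp add: algebra_simps power2_eq_square)
      also have "\<dots> < n + 1" using n t2 t by linarith
      finally show False using 1 by simp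
    qed
    have "3 * n \<le> 3 * (c * (t + 1))" using 1 by simp
    also have "\<dots> = 3 * (t + 1) * c" by simp
    also have "\<dots> \<le> (c - 1) * (2 * (n - s) - c)"
      using \<open>3 * (t + 1) \<le> c - 1\<close> s c t by (intro mult_mono) auto
    finally show ?thesis .
  next
    case 2
    have "(n + 1) \<le> (t + 1) * (2 * (n + 1) - (2 * t + 1) * c)"
    proof -
      have "(2 * t + 1) * (c * (t + 1)) \<le> (2 * t + 1) * (n + 1)"
        using 2 t by (intro mult_left_mono) auto
      then show ?thesis by (simp add: algebra_simps)
    qed
    also have "\<dots> \<le> (t + 1) * (2 * (n - s) - c)"
      using s t by (intro mult_left_mono) (auto simp: algebra_simps)
    finally have *: "n + 1 \<le> (t + 1) * (2 * (n - s) - c)" .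
    have "3 * n \<le> 3 * ((t + 1) * (2 * (n - s) - c))" using * by linarith
    also have "\<dots> \<le> (c - 1) * (2 * (n - s) - c)"
      unfolding mult.assoc[symmetric] using 2 s c t by (intro mult_right_mono) auto
    finally show ?thesis .
  next
    case 3
    have "(c - 3) * (2 * n - 10 * t - 3 - (2 * t + 1) * (c - 3)) \<ge> 0"
    proof -
      have "(2 * t + 1) * (c - 3) \<le> (2 * t + 1) * (3 * t + 1)" using 3 t by (intro mult_left_mono) auto
      also have "\<dots> = 6 * t\<^sup>2 + 5 * t + 1" by (simp add: algebra_simps power2_eq_square)
      finally show ?thesis using c n t t2 by (intro mult_nonneg_nonneg) auto
    qed
    moreover have "n \<ge> 12 * t + 2" using n t t2 by linarith
    moreover have "(c - 1) * (2 * (n + 1) - (2 * t + 1) * c) =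
        4 * n - 12 * t - 2 + (c - 3) * (2 * n - 10 * t - 3 - (2 * t + 1) * (c - 3))"
      by (simp add: algebra_simps)
    moreover have "(c - 1) * (2 * (n + 1) - (2 * t + 1) * c) \<le> (c - 1) * (2 * (n - s) - c)"
      using s c by (intro mult_left_mono) (auto simp: algebra_simps)
    ultimately show ?thesis by linarith
  qed
qed

section \<open>Non-tough graphs\<close>

lemma reachable_refl: "u \<in> gverts G \<Longrightarrow> reachable G u u"
  unfolding reachable_def by (intro exI[of _ "[u]"]) (simp add: walk_iff_successively)

lemma reachable_sym: "simple_graph G \<Longrightarrow> reachable G u v \<Longrightarrow> reachable G v u"
  unfolding reachable_def using walk_rev by (metis hd_rev last_rev)

lemma reachable_adj: "simple_graph G \<Longrightarrow> gadj G u v \<Longrightarrow> reachable G u v"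
  unfolding reachable_def
  by (intro exI[of _ "[u, v]"]) (auto simp: walk_iff_successively simple_graph_def)

lemma reachable_trans:
  assumes "reachable G u v" "reachable G v w"
  shows "reachable G u w"
proof -
  obtain xs ys where xs: "walk G xs" "hd xs = u" "last xs = v" and ys: "walk G ys" "hd ys = v" "last ys = w"
    using assms by (auto simp: reachable_def)
  then obtain zs where "ys = v # zs" by (cases ys) (auto simp: walk_def)
  with xs ys have "walk G (xs @ zs) \<and> hd (xs @ zs) = u \<and> last (xs @ zs) = w"
    by (cases zs) (auto simp: walk_iff_successively successively_append_iff)
  then show ?thesis unfolding reachable_def by blast
qed

lemma partition_on_components:
  assumes "simple_graph H"
  shows "partition_on (gverts H) {{v \<in> gverts H. reachable H u v} | u. u \<in> gverts H}"
proof -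
  have "{{v \<in> gverts H. reachable H u v} | u. u \<in> gverts H} =
      gverts H // {(u, v). u \<in> gverts H \<and> v \<in> gverts H \<and> reachable H u v}"
    by (auto simp: quotient_def)
  moreover have "equiv (gverts H) {(u, v). u \<in> gverts H \<and> v \<in> gverts H \<and> reachable H u v}"
  proof (rule equivI)
    show "refl_on (gverts H) {(u, v). u \<in> gverts H \<and> v \<in> gverts H \<and> reachable H u v}"
      by (simp add: refl_on_def reachable_refl)
    show "sym {(u, v). u \<in> gverts H \<and> v \<in> gverts H \<and> reachable H u v}"
      using reachable_sym[OF assms] by (simp add: sym_def)
    show "trans {(u, v). u \<in> gverts H \<and> v \<in> gverts H \<and> reachable H u v}"
      unfolding trans_def by (simp, metis reachable_trans)
  qed auto
  ultimately show ?thesis by (simp add: partition_on_quotient)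
qed

lemma simple_graph_delete_verts: "simple_graph G \<Longrightarrow> simple_graph (delete_verts G S)"
  by (auto simp: simple_graph_def delete_verts_def)

lemma separates_components:
  assumes "simple_graph G" "S \<subseteq> gverts G"
  obtains P where "separates G S P" "card P = num_components (delete_verts G S)"
proof -
  let ?H = "delete_verts G S"
  let ?P = "{{v \<in> gverts ?H. reachable ?H u v} | u. u \<in> gverts ?H}"
  have H: "simple_graph ?H" using assms simple_graph_delete_verts by blast
  have V: "gverts ?H = gverts G - S" by (simp add: delete_verts_def)
  have "\<exists>B\<in>?P. u \<in> B \<and> v \<in> B" if "u \<in> gverts G - S" "v \<in> gverts G - S" "gadj G u v" for u v
  proof -
    have "gadj ?H u v" using that by (simp add: delete_verts_def)
    then have "reachable ?H u v" "reachable ?H u u"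
      using reachable_adj[OF H] reachable_refl[of u ?H] that V by auto
    then have "u \<in> {w \<in> gverts ?H. reachable ?H u w}" "v \<in> {w \<in> gverts ?H. reachable ?H u w}"
      using that V by simp_all
    moreover have "{w \<in> gverts ?H. reachable ?H u w} \<in> ?P" using that V by auto
    ultimately show ?thesis by (intro bexI[of _ "{w \<in> gverts ?H. reachable ?H u w}"] conjI)
  qed
  then have "separates G S ?P"
    using partition_on_components[OF H] assms(2) unfolding separates_def V by simp
  then show ?thesis using that by (simp add: num_components_def)
qed

text \<open>Keeps the \<open>Min\<close> in \<open>toughness\<close> from ranging over the empty
  set: all but two nonadjacent vertices are deleted.\<close>

lemma vertex_cut_exists:
  assumes "simple_graph G" "\<not> is_complete G"
  shows "\<exists>S. vertex_cut G S"
proof -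
  obtain u v where uv: "u \<in> gverts G" "v \<in> gverts G" "u \<noteq> v" "\<not> gadj G u v"
    using assms(2) by (auto simp: is_complete_def)
  define S where "S = gverts G - {u, v}"
  define H where "H = delete_verts G S"
  have VH: "gverts H = {u, v}" using uv by (auto simp: H_def S_def delete_verts_def)
  have noadj: "\<not> gadj H a b" for a b
    using uv assms(1) by (auto simp: H_def S_def delete_verts_def simple_graph_def)
  have "a = b" if r: "reachable H a b" for a b
  proof -
    obtain xs where xs: "walk H xs" "hd xs = a" "last xs = b" using r by (auto simp: reachable_def)
    then obtain ys where ys: "xs = a # ys" by (cases xs) (auto simp: walk_def)
    then have "ys = []" using xs noadj by (cases ys) (auto simp: walk_iff_successively)
    with xs ys show ?thesis by simp
  qed
  then have comp: "{w \<in> gverts H. reachable H a w} = {a}" if "a \<in> gverts H" for a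
    using that reachable_refl[of a H] by blast
  have "{{w \<in> gverts H. reachable H a w} | a. a \<in> gverts H} = (\<lambda>a. {a}) ` gverts H"
    using comp by auto
  then have "num_components H = 2"
    unfolding num_components_def using uv by (simp add: VH)
  then show ?thesis unfolding vertex_cut_def by (intro exI[of _ S]) (simp add: H_def S_def Diff_subset)
qed

lemma not_tough_separates:
  assumes G: "simple_graph G" "connected_graph G" and nt: "\<not> tough G t"
  obtains S P where "separates G S P" "card P \<ge> 2" "real (card S) < t * real (card P)" "S \<noteq> {}"
proof -
  let ?R = "{real (card S) / real (num_components (delete_verts G S)) | S. vertex_cut G S}"
  have nc: "\<not> is_complete G" and lt: "toughness G < t" using nt by (auto simp: tough_def)
  have "?R \<subseteq> (\<lambda>S. real (card S) / real (num_components (delete_verts G S))) ` Pow (gverts G)"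
    by (auto simp: vertex_cut_def)
  then have "finite ?R"
    using G(1) by (meson finite_Pow_iff finite_imageI finite_subset simple_graph_def)
  moreover have "?R \<noteq> {}" using vertex_cut_exists[OF G(1) nc] by blast
  ultimately have "toughness G \<in> ?R" unfolding toughness_def by (rule Min_in)
  then obtain S where S: "vertex_cut G S"
    "real (card S) / real (num_components (delete_verts G S)) < t" using lt by auto
  have SV: "S \<subseteq> gverts G" and c2: "num_components (delete_verts G S) \<ge> 2"
    using S(1) by (auto simp: vertex_cut_def)
  \<comment> \<open>The empty set is no cut, since a connected graph has only one component.\<close>
  have "S \<noteq> {}"
  proof
    assume "S = {}"
    then have "delete_verts G S = G" by (simp add: delete_verts_def)
    with c2 have "num_components G \<ge> 2" by simp
    moreover have "{{v \<in> gverts G. reachable G u v} | u. u \<in> gverts G} \<subseteq> {gverts G}"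
      using G(2) by (auto simp: connected_graph_def)
    then have "num_components G \<le> card {gverts G}"
      unfolding num_components_def by (intro card_mono) auto
    ultimately show False by simp
  qed
  obtain P where P: "separates G S P" "card P = num_components (delete_verts G S)"
    using separates_components[OF G(1) SV] .
  moreover have "real (card S) < t * real (card P)"
    using S(2) c2 P(2) by (simp add: divide_less_eq)
  ultimately show ?thesis using that c2 \<open>S \<noteq> {}\<close> by simp
qed

text \<open>Rayleigh quotient of the all-ones vector. Among block structures with \<open>c\<close>
  blocks, one large block and singletons leave the fewest pairs in different blocks.\<close>

lemma dist_lambda1_ge_average:
  assumes G: "simple_graph G" "connected_graph G" "separates G S P" and "P \<noteq> {}"
  defines "n \<equiv> real (card (gverts G))" and "s \<equiv> real (card S)" and "c \<equiv> real (card P)"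
  shows "n * (n - 1) + (c - 1) * (2 * (n - s) - c) \<le> dist_lambda1 G * n"
proof -
  define V where "V = gverts G"
  have fin: "finite V" and V: "S \<subseteq> V" "partition_on (V - S) P" and ne: "V \<noteq> {}"
    using G by (auto simp: simple_graph_def separates_def connected_graph_def V_def)
  note blocks = finite_blocks[OF fin V]
  have N: "real (card (V - S)) = n - s"
    using V fin finite_subset[OF V(1)] card_mono[OF fin V(1)]
    by (simp add: card_Diff_subset n_def s_def V_def of_nat_diff)
  have "(\<Sum>B\<in>P. (real (card B))\<^sup>2) \<le> (n - s - c + 1)\<^sup>2 + (c - 1)"
    using sum_card_squares_le[OF blocks(1,4) sum_card_blocks[OF fin V(2)] assms(4)] N by (simp add: c_def)
  then have "n * (n - 1) + (c - 1) * (2 * (n - s) - c) \<le> (\<Sum>u\<in>V. \<Sum>v\<in>V. block_dist S P u v)"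
    unfolding sum_block_dist[OF fin V] N
    by (simp add: n_def[folded V_def, symmetric] algebra_simps power2_eq_square)
  also have "\<dots> \<le> (\<Sum>u\<in>V. \<Sum>v\<in>V. real (gdist G u v))"
    using block_dist_le_gdist[OF G(2,3)] by (intro sum_mono) (auto simp: V_def)
  also have "\<dots> = quad_form V (\<lambda>u v. real (gdist G u v)) (\<lambda>_. 1)"
    by (simp add: quad_form_def)
  also have "\<dots> \<le> dist_lambda1 G * n"
    using rayleigh_le_dist_lambda1[OF G(1), of "\<lambda>_. 1"] ne by (simp add: V_def n_def)
  finally show ?thesis .
qed

section \<open>The extremal graphs and the two cases\<close>

lemma graph_join_complete_edgeless:
  fixes I :: "'b sgraph" and a b :: nat
  assumes "finite (gverts I)" "\<And>x y. \<not> gadj I x y"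
  defines "J \<equiv> graph_join (complete_graph a) (disj_union (complete_graph b) I)"
  shows "simple_graph J"
    and "join_clique_isolated J (Inl ` {0..<a}) (Inr ` Inr ` gverts I)"
    and "card (gverts J) = a + b + card (gverts I)"
proof -
  have V: "gverts J = Inl ` {0..<a} \<union> Inr ` (Inl ` {0..<b} \<union> Inr ` gverts I)"
    by (simp add: J_def graph_join_def disj_union_def complete_graph_def)
  have adj: "gadj J x y \<longleftrightarrow> x \<in> gverts J \<and> y \<in> gverts J \<and> x \<noteq> y \<and>
      (x \<in> Inl ` {0..<a} \<or> y \<in> Inl ` {0..<a} \<or> (x \<notin> Inr ` Inr ` gverts I \<and> y \<notin> Inr ` Inr ` gverts I))" for x y
    unfolding V using assms(2)
    by (cases x; cases y; (cases "projr x")?; (cases "projr y")?)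
      (auto simp: J_def graph_join_def disj_union_def complete_graph_def)
  show "simple_graph J"
    unfolding simple_graph_def using adj assms(1) by (auto simp: V)
  show "join_clique_isolated J (Inl ` {0..<a}) (Inr ` Inr ` gverts I)"
    unfolding join_clique_isolated_def using adj by (auto simp: V)
  show "card (gverts J) = a + b + card (gverts I)"
    unfolding V using assms(1)
    by (subst card_Un_disjoint, simp, simp, blast, subst card_image, simp, subst card_image, simp,
        subst card_Un_disjoint) (auto simp: card_image)
qed

text \<open>Here \<open>j\<close> is only a lower bound for the number of blocks, and
  \<open>M\<close> is the size of the large block if there are exactly \<open>j\<close>. Concavity
  moves the inequality from the extremal sizes to the actual blocks, and rigidity moves the equality
  back.\<close>

lemma separates_extremal:
  assumes G: "simple_graph G" "connected_graph G" "separates G S P" "card (gverts G) = n"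
    and L: "L > real (card S)" and j: "1 \<le> j" "j \<le> card P"
    and ge: "M / (L + M) + (real j - 1) / (L + 1) \<ge> (L - real (card S)) / (2 * L - real (card S))"
    and M: "M = real n - real (card S) - real j + 1"
    and le: "dist_lambda1 G \<le> L - 1"
  shows "M / (L + M) + (real j - 1) / (L + 1) = (L - real (card S)) / (2 * L - real (card S))"
    and "\<exists>W. join_clique_isolated G S W \<and> Suc (card W) = j"
proof -
  define V where "V = gverts G"
  have fin: "finite V" and V: "S \<subseteq> V" "partition_on (V - S) P"
    using G by (auto simp: simple_graph_def separates_def V_def)
  note blocks = finite_blocks[OF fin V]
  have N: "real (card (V - S)) = real n - real (card S)"
    using fin finite_subset[OF V(1)] card_mono[OF fin V(1)] G(4) V(1)
    by (simp add: card_Diff_subset V_def of_nat_diff)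
  have L0: "L > 0" using L by linarith
  note bs = block_sum_ge[OF blocks(1,4) sum_card_blocks[OF fin V(2)] L0 j, unfolded N, folded M]
  have "block_sum L P \<ge> (L - real (card S)) / (2 * L - real (card S))"
    using ge bs(1) by linarith
  note eq = dist_lambda1_secular_bound[OF G(1-3) L this le]
  show eqM: "M / (L + M) + (real j - 1) / (L + 1) = (L - real (card S)) / (2 * L - real (card S))"
    using eq(1) bs(1) ge by linarith
  with eq(1) bs(2) obtain B where B: "card P = j" "B \<in> P" "real (card B) = M" by auto
  have "real (card B + card P) = real (card (V - S) + 1)" using B M N by simp
  then have "card B + card P = card (gverts G - S) + 1" unfolding V_def of_nat_eq_iff .
  from join_clique_isolated_of_extremal_blocks[OF G(1-3) eq(2) B(2) this] B(1)
  show "\<exists>W. join_clique_isolated G S W \<and> Suc (card W) = j" by simp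
qed

lemma separates_card_le:
  assumes "simple_graph G" "separates G S P" "P \<noteq> {}"
  shows "card S + card P \<le> card (gverts G)"
proof -
  have fin: "finite (gverts G)" and V: "S \<subseteq> gverts G" "partition_on (gverts G - S) P"
    using assms by (auto simp: simple_graph_def separates_def)
  note blocks = finite_blocks[OF fin V]
  obtain B where "B \<in> P" using assms(3) by blast
  then have "card P \<le> card (gverts G - S)"
    using card_block_le[OF blocks(1,4) sum_card_blocks[OF fin V(2)]] blocks(4)[of B] by fastforce
  then show ?thesis
    using card_Diff_subset[OF finite_subset[OF V(1) fin] V(1)] card_mono[OF fin V(1)] by linarith
qed

lemma tough_integer:
  fixes G :: "'a sgraph"
  assumes G: "simple_graph G" "connected_graph G" "card (gverts G) = n"
    and t: "t > 0" "n \<ge> 4 * t^2 + 10 * t"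
  defines "H \<equiv> graph_join (complete_graph (2*t - 1)) (disj_union (complete_graph (n - 2*t)) (complete_graph 1))"
  assumes le: "dist_lambda1 G \<le> dist_lambda1 H" and nt: "\<not> tough G (real t)"
  shows "graph_iso G H"
proof -
  define s where "s = 2 * t - 1"
  define m where "m = n - 2 * t"
  have nm: "n = s + m + 1" "s \<ge> 1" "m \<ge> 1" and st: "real s = 2 * real t - 1"
    using t by (auto simp: s_def m_def)
  have edgeless: "finite (gverts (complete_graph 1))" "\<not> gadj (complete_graph 1) x y"
    "card (gverts (complete_graph 1)) = 1" for x y
    by (auto simp: complete_graph_def)
  note H = graph_join_complete_edgeless[OF edgeless(1,2), of s m, folded s_def m_def H_def[folded s_def m_def], unfolded edgeless(3)]
  have card: "card ((Inl :: _ \<Rightarrow> nat + nat + nat) ` {0..<s}) = s"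
    "card ((Inr :: _ \<Rightarrow> nat + nat + nat) ` Inr ` gverts (complete_graph 1)) = 1"
    using edgeless(3) by (simp_all add: card_image)
  obtain L where L: "real n \<le> L" "real m / (L + real m) + 1 / (L + 1) = (L - real s) / (2 * L - real s)"
    using secular_root_exists[of "real s" "real m" 1 "real n"] nm by auto
  have "dist_lambda1 H \<le> L - 1"
    by (rule dist_lambda1_join_clique_isolated_le[OF H(1,2), of m L, unfolded card]) (use H(3) nm L in auto)
  with le have G_le: "dist_lambda1 G \<le> L - 1" by linarith
  note root = secular_single_isolated_root[of "real n" "real s" "real m" L, OF _ _ _ L]
  obtain S P where sep: "separates G S P" "card P \<ge> 2" "real (card S) < real t * real (card P)"
    using not_tough_separates[OF G(1,2) nt] by metis
  have S_lt: "card S + 1 \<le> t * card P"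
    using sep(3) by (simp flip: of_nat_mult)
  have Pne: "P \<noteq> {}" using sep(2) by auto
  have sc: "card S + card P \<le> n" using separates_card_le[OF G(1) sep(1) Pne] G(3) by simp
  have "card P = 2"
  proof (rule ccontr)
    assume "card P \<noteq> 2"
    then have "card P \<ge> 3" using sep(2) by simp
    have "3 * real n \<le> (real (card P) - 1) * (2 * (real n - real (card S)) - real (card P))"
    proof (rule nonadjacent_pairs_bound)
      show "4 * (real t)\<^sup>2 + 10 * real t \<le> real n" using t(2) by (simp flip: of_nat_power of_nat_mult of_nat_add)
      show "real (card S) \<le> real t * real (card P) - 1" using S_lt by (simp flip: of_nat_mult)
    qed (use t sc \<open>card P \<ge> 3\<close> in auto)
    \<comment> \<open>Since n(n - 1) + 3n = n(n + 2), the eigenvalue would be at least n + 2,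
      against \<open>L < n + 3\<close>.\<close>
    with dist_lambda1_ge_average[OF G(1,2) sep(1) Pne]
    have "real n * (real n + 2) \<le> dist_lambda1 G * real n" by (simp add: G(3) algebra_simps)
    then have "real n + 2 \<le> dist_lambda1 G" using nm by simp
    with G_le root(1) nm show False by simp
  qed
  then have "card S \<le> s" using S_lt by (simp add: s_def)
  define M where "M = real n - real (card S) - 1"
  have Ls: "L > real (card S)" using sc \<open>card P = 2\<close> L(1) by linarith
  have extr: "M / (L + M) + 1 / (L + 1) = (L - real (card S)) / (2 * L - real (card S)) \<and>
      (\<exists>W. join_clique_isolated G S W \<and> Suc (card W) = 2)"
    if "M / (L + M) + 1 / (L + 1) \<ge> (L - real (card S)) / (2 * L - real (card S))"
    using separates_extremal[OF G(1,2) sep(1) G(3) Ls _ _ _ _ G_le, of 2 M] that \<open>card P = 2\<close>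
    by (simp add: M_def)
  \<comment> \<open>A smaller cut has strictly positive defect at the same \<open>L\<close>, while
    \<open>extr\<close> forces the defect to be 0.\<close>
  have "card S = s"
  proof (rule ccontr)
    assume "card S \<noteq> s"
    with \<open>card S \<le> s\<close> have "real (card S) < real s" by simp
    with root(2)[of "real (card S)"] nm
    have "M / (L + M) + 1 / (L + 1) > (L - real (card S)) / (2 * L - real (card S))"
      by (simp add: M_def)
    with extr show False by simp
  qed
  moreover have "M = real m" using calculation nm by (simp add: M_def)
  ultimately obtain W where "join_clique_isolated G S W" "card W = 1"
    using extr L by auto
  then show ?thesis
    using H(1,3) card \<open>card S = s\<close> G nm
    by (intro graph_iso_join_clique_isolated[OF _ _ H(2)]) (auto simp: simple_graph_def)
qed

lemma tough_reciprocal: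
  fixes G :: "'a sgraph" and t :: real
  assumes G: "simple_graph G" "connected_graph G" "card (gverts G) = n"
    and t: "t > 0" "k \<ge> 1" "1 / t = real k" "real n \<ge> 2 * t + 9 / (2 * t) + 9 / 2"
  defines "H \<equiv> graph_join (complete_graph 1)
    (disj_union (complete_graph (n - 1 - k)) (copies k (complete_graph 1)))"
  assumes le: "dist_lambda1 G \<le> dist_lambda1 H" and nt: "\<not> tough G t"
  shows "graph_iso G H"
proof -
  define m where "m = n - 1 - k"
  have "9 / (2 * t) = 9 / 2 * (1 / t)" by simp
  with t have n: "2 * real n \<ge> 9 * real k + 9" by (simp add: t(3))
  then have nm: "n = 1 + m + k" "m \<ge> 1" using t(2) by (auto simp: m_def)
  have edgeless: "finite (gverts (copies k (complete_graph 1)))" "\<not> gadj (copies k (complete_graph 1)) x y"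
    "card (gverts (copies k (complete_graph 1))) = k" for x y
    by (auto simp: complete_graph_def copies_def split: prod.splits)
  note H = graph_join_complete_edgeless[OF edgeless(1,2), of 1 m, folded m_def H_def[folded m_def], unfolded edgeless(3)]
  have card: "card ((Inl :: _ \<Rightarrow> nat + nat + nat \<times> nat) ` {0..<1}) = 1"
    "card ((Inr :: _ \<Rightarrow> nat + nat + nat \<times> nat) ` Inr ` gverts (copies k (complete_graph 1))) = k"
    using edgeless(3) by (simp_all add: card_image)
  obtain L where L: "real n \<le> L" "real m / (L + real m) + real k / (L + 1) = (L - 1) / (2 * L - 1)"
    using secular_root_exists[of 1 "real m" "real k" "real n"] nm by auto
  have "dist_lambda1 H \<le> L - 1"
    by (rule dist_lambda1_join_clique_isolated_le[OF H(1,2), of m L, unfolded card]) (use H(3) nm L in auto)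
  with le have G_le: "dist_lambda1 G \<le> L - 1" by linarith
  obtain S P where sep: "separates G S P" "card P \<ge> 2" "real (card S) < t * real (card P)" "S \<noteq> {}"
    using not_tough_separates[OF G(1,2) nt] by metis
  define s where "s = card S"
  have "real k * t = 1" using t by (simp add: field_simps)
  have "real k * real s < real k * (t * real (card P))"
    using sep(3) t(2) by (simp add: s_def)
  also have "\<dots> = real (card P)" using \<open>real k * t = 1\<close> by (simp flip: mult.assoc)
  \<comment> \<open>Integrality turns the strict inequality into one extra block:
    \<open>k * s\<close> isolated vertices besides the large block. For \<open>s = 1\<close> this is
    the extremal structure.\<close>
  finally have j: "k * s + 1 \<le> card P" by (simp flip: of_nat_mult)
  have Pne: "P \<noteq> {}" using sep(2) by auto
  have sc: "s + card P \<le> n" using separates_card_le[OF G(1) sep(1) Pne] G(3) by (simp add: s_def)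
  have "S \<subseteq> gverts G" "finite (gverts G)" using sep(1) G(1) by (auto simp: separates_def simple_graph_def)
  then have s1: "s \<ge> 1" using sep(4) finite_subset by (fastforce simp: s_def Suc_le_eq card_gt_0_iff)
  define M where "M = real n - real s - real k * real s"
  have Ls: "L > real (card S)" using sc sep(2) L(1) unfolding s_def by linarith
  have extr: "M / (L + M) + real k * real s / (L + 1) = (L - real s) / (2 * L - real s) \<and>
      (\<exists>W. join_clique_isolated G S W \<and> Suc (card W) = k * s + 1)"
    if "M / (L + M) + real k * real s / (L + 1) \<ge> (L - real s) / (2 * L - real s)"
    using separates_extremal[OF G(1,2) sep(1) G(3) Ls _ j _ _ G_le, of M] that
    by (simp add: M_def s_def)
  have "s = 1"
  proof (rule ccontr)
    assume "s \<noteq> 1"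
    have "M / (L + M) + real k * real s / (L + 1) > (L - real s) / (2 * L - real s)"
    proof (rule secular_strict_reciprocal[OF _ _ _ n L(1) _ M_def])
      show "real s + real k * real s + 1 \<le> real n" using sc j by (simp flip: of_nat_mult of_nat_add)
    qed (use t(2) s1 \<open>s \<noteq> 1\<close> nm L(2) in auto)
    with extr show False by simp
  qed
  then have "M = real m" using nm by (simp add: M_def)
  with \<open>s = 1\<close> obtain W where "join_clique_isolated G S W" "card W = k"
    using extr L by auto
  then show ?thesis
    using H(1,3) card \<open>s = 1\<close> G nm
    by (intro graph_iso_join_clique_isolated[OF _ _ H(2)]) (auto simp: simple_graph_def s_def)
qed

theorem theorem1p2:
  fixes G :: "'a sgraph"
  shows
  "(\<forall>(t::nat) n. simple_graph G \<and> connected_graph G \<and> card (gverts G) = n \<and>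
      t > 0 \<and> n \<ge> 4 * t^2 + 10 * t \<and>
      dist_lambda1 G \<le> dist_lambda1 (graph_join (complete_graph (2*t - 1))
                         (disj_union (complete_graph (n - 2*t)) (complete_graph 1)))
      \<longrightarrow> tough G (real t) \<or>
          graph_iso G (graph_join (complete_graph (2*t - 1))
                         (disj_union (complete_graph (n - 2*t)) (complete_graph 1))))
   \<and>
   (\<forall>(t::real) (k::nat) n. simple_graph G \<and> connected_graph G \<and> card (gverts G) = n \<and>
      t > 0 \<and> k \<ge> 1 \<and> 1 / t = real k \<and>
      real n \<ge> 2 * t + 9 / (2 * t) + 9 / 2 \<and>
      dist_lambda1 G \<le> dist_lambda1 (graph_join (complete_graph 1)
                         (disj_union (complete_graph (n - 1 - k)) (copies k (complete_graph 1))))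
      \<longrightarrow> tough G t \<or>
          graph_iso G (graph_join (complete_graph 1)
                         (disj_union (complete_graph (n - 1 - k)) (copies k (complete_graph 1)))))"
  using tough_integer tough_reciprocal by blast

end
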